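(* Let $X$ be a finite multiset of nonzero vectors spanning $\mathbb{R}^n$, and let $\mathbb{I}'$ be a semi-external subset of $\mathbb{I}(X)$ with $\mathbb{B}(X)\subset\mathbb{I}'\subset\mathbb{I}(X)$. Suppose that $\mathbb{I}'$ satisfies the following additional condition: for any $I\in\mathbb{I}(X)\setminus\mathbb{B}(X)$, $\mathcal{M}(I)\subset\mathbb{I}'$ implies $I\in\mathbb{I}'$. Then: (1) $\mathcal{I}_+(X,\mathbb{I}')=\mathcal{I}_\varepsilon(X,\mathbb{I}')$. (2) $$\mathcal{P}_+(X,\mathbb{I}')=\sum_{I\text{ is minimal in }\mathbb{I}'}\ \Big(\bigcap_{Z\in\mathrm{Comp}_I(X)}\mathcal{P}(X\sqcup Z)\Big),$$ where $I$ is minimal in $\mathbb{I}'$ provided $I\in\mathbb{I}'$ and no proper subset of $I$ lies in $\mathbb{I}'$, and where $\mathrm{Comp}_I(X):=\{Z\subset X:\ I\cup Z\in\mathbb{B}(X)\}$ denotes the set of all completions of $I$ to a basis.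
   Context: **Polynomials.** $\Pi=\mathbb{C}[t_1,\dots,t_n]$, and $\Pi_k^0$ is its subspace of homogeneous polynomials of degree $k$ (including $0$). For $x\in\mathbb{R}^n$, $p_x(t):=x\cdot t$ (standard inner product). For a finite multiset $Y$ of vectors, $p_Y:=\prod_{y\in Y}p_y$, with $p_\emptyset=1$. **The multiset $X$.** $X$ is a finite multiset of nonzero vectors spanning $\mathbb{R}^n$ (the columns of an $n\times N$ matrix of rank $n$). Repeated vectors are distinct elements of $X$, subsets of $X$ are submultisets, and cardinalities count multiplicities. $\mathbb{B}(X)$ is the collection of subsets of $X$ that are bases of $\mathbb{R}^n$. $\mathbb{I}(X)$ is the collection of all linearly independent subsets of $X$ (including $\emptyset$). For a subspace $S$, $X\setminus S$ is the multiset of elements of $X$ not in $S$. $\sqcup$ denotes multiset union (multiplicities add). **Semi-external collections.** $\mathbb{I}'\subset\mathbb{I}(X)$ is semi-external if: whenever $I\in\mathbb{I}'$, $I'\in\mathbb{I}(X)$ and $\mathrm{span}\,I\subset\mathrm{span}\,I'$, then $I'\in\mathbb{I}'$. **Facets and ideals.** A facet hyperplane of $X$ is an $(n-1)$-dimensional subspace spanned by a subset of $X$. $\mathcal{F}(X)$ is the set of these. For $F\in\mathcal{F}(X)$, $\eta_F$ is a nonzero normal to $F$ (unique up to scalar) and $m(F):=\#(X\setminus F)$. For $I\in\mathbb{I}(X)\setminus\mathbb{B}(X)$, $$\mathcal{M}(I):=\{I'\in\mathbb{I}(X):\ I\subset\mathrm{span}(I')\in\mathcal{F}(X)\}.$$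 Define - $\mathcal{I}_+(X):=\mathrm{Ideal}\{p_{\eta_F}^{m(F)+1}:\ F\in\mathcal{F}(X)\}$. - $S(X,\mathbb{I}'):=\{\mathrm{span}\,I:\ I\in\mathbb{I}(X)\setminus\mathbb{I}'\}$. - For a subspace $S\subset\mathbb{R}^n$, $\Pi_j^0(S\perp):=\{p\in\Pi_j^0:\ D_\eta p=0\text{ for all }\eta\in S\}$, where $D_\eta$ is the directional derivative along $\eta$ (homogeneous polynomials of degree $j$ on the orthogonal complement of $S$). - $\mathcal{I}_+(X,\mathbb{I}'):=\mathcal{I}_+(X)+\mathrm{Ideal}\big(\bigcup_{S\in S(X,\mathbb{I}')}\Pi^0_{\#(X\setminus S)}(S\perp)\big)$. - $\mathcal{I}_\varepsilon(X,\mathbb{I}'):=\mathrm{Ideal}\{p_{\eta_F}^{m(F)+\varepsilon(F)}:\ F\in\mathcal{F}(X)\}$, where $\varepsilon(F):=1$ if $F=\mathrm{span}(I)$ for some $I\in\mathbb{I}'$, and $\varepsilon(F):=0$ otherwise. - $\mathcal{P}_+(X,\mathbb{I}'):=\mathrm{span}\{p_Y:\ Y\subset X,\ Y\cap I=\emptyset\text{ for some }I\in\mathbb{I}'\}$. - For any finite multiset $A$ of nonzero vectors in $\mathbb{R}^n$, $\mathcal{P}(A):=\mathrm{span}\{p_Y:\ Y\subset A,\ \mathrm{rank}(A\setminus Y)=n\}$. *)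

theory Defs
  imports "HOL-Analysis.Analysis" "HOL-Library.Poly_Mapping"
begin

section \<open>Complex polynomials in variables indexed by a finite type\<close>

text \<open>The ring \<open>\<complex>[t\<^sub>1,\<dots>,t\<^sub>n]\<close> with \<open>n = CARD('n)\<close>: a polynomial maps exponent vectors to
  coefficients, and multiplication is the convolution product of \<^theory>\<open>HOL-Library.Poly_Mapping\<close>.\<close>

type_synonym 'n cpoly = "('n \<Rightarrow>\<^sub>0 nat) \<Rightarrow>\<^sub>0 complex"

definition poly_scale :: "complex \<Rightarrow> 'n cpoly \<Rightarrow> 'n cpoly" where
  "poly_scale c p = Poly_Mapping.single 0 c * p"

global_interpretation cpoly: vector_space "poly_scale :: complex \<Rightarrow> 'n cpoly \<Rightarrow> 'n cpoly"
  defines cpoly_span = cpoly.span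
  by unfold_locales
    (simp_all add: poly_scale_def algebra_simps single_add mult_single flip: mult.assoc)

global_interpretation ideal: module "(*) :: 'a::comm_ring_1 \<Rightarrow> 'a \<Rightarrow> 'a"
  defines ideal_of = ideal.span
  by unfold_locales (simp_all add: algebra_simps)

definition homogeneous :: "nat \<Rightarrow> ('n::finite) cpoly set" where
  "homogeneous k = {p. \<forall>m\<in>Poly_Mapping.keys p. (\<Sum>i\<in>UNIV. Poly_Mapping.lookup m i) = k}"

definition linear_poly :: "real ^ 'n \<Rightarrow> ('n::finite) cpoly" where
  "linear_poly x =
     (\<Sum>i\<in>UNIV. Poly_Mapping.single (Poly_Mapping.single i 1) (complex_of_real (x $ i)))"

text \<open>The truncated subtraction of exponents is harmless: monomials not containing the variable
  \<open>i\<close> get coefficient \<open>0\<close>.\<close>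

definition partial_deriv :: "'n \<Rightarrow> 'n cpoly \<Rightarrow> 'n cpoly" where
  "partial_deriv i p =
     (\<Sum>m\<in>Poly_Mapping.keys p.
        Poly_Mapping.single (m - Poly_Mapping.single i 1)
          (of_nat (Poly_Mapping.lookup m i) * Poly_Mapping.lookup p m))"

definition dir_deriv :: "real ^ 'n \<Rightarrow> ('n::finite) cpoly \<Rightarrow> 'n cpoly" where
  "dir_deriv \<eta> p = (\<Sum>i\<in>UNIV. poly_scale (complex_of_real (\<eta> $ i)) (partial_deriv i p))"

definition homogeneous_perp :: "nat \<Rightarrow> (real ^ 'n) set \<Rightarrow> ('n::finite) cpoly set" where
  "homogeneous_perp j S = {p \<in> homogeneous j. \<forall>\<eta>\<in>S. dir_deriv \<eta> p = 0}"


section \<open>Finite multisets of vectors\<close>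

text \<open>A finite multiset of vectors is a family \<open>v\<close> restricted to a finite set \<open>E\<close> of labels, so that
  repeated vectors are distinct elements; its submultisets are the subsets of \<open>E\<close>. A set of labels
  is linearly independent when the family is, which forces \<open>v\<close> to be injective on it.\<close>

definition indep_sets :: "('e \<Rightarrow> real ^ 'n) \<Rightarrow> 'e set \<Rightarrow> 'e set set" where
  "indep_sets v E = {I. I \<subseteq> E \<and> inj_on v I \<and> independent (v ` I)}"

definition bases :: "('e \<Rightarrow> real ^ 'n) \<Rightarrow> 'e set \<Rightarrow> 'e set set" where
  "bases v E = {B \<in> indep_sets v E. span (v ` B) = UNIV}"

definition outside :: "('e \<Rightarrow> real ^ 'n) \<Rightarrow> 'e set \<Rightarrow> (real ^ 'n) set \<Rightarrow> 'e set" where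
  "outside v E S = {e \<in> E. v e \<notin> S}"

definition semi_external :: "('e \<Rightarrow> real ^ 'n) \<Rightarrow> 'e set \<Rightarrow> 'e set set \<Rightarrow> bool" where
  "semi_external v E J \<longleftrightarrow> J \<subseteq> indep_sets v E \<and>
     (\<forall>I\<in>J. \<forall>I'\<in>indep_sets v E. span (v ` I) \<subseteq> span (v ` I') \<longrightarrow> I' \<in> J)"

definition facets :: "('e \<Rightarrow> real ^ 'n) \<Rightarrow> 'e set \<Rightarrow> (real ^ 'n) set set" where
  "facets v E = {F. (\<exists>Y\<subseteq>E. F = span (v ` Y)) \<and> dim F = CARD('n) - 1}"

definition facet_spanning ::
    "('e \<Rightarrow> real ^ 'n) \<Rightarrow> 'e set \<Rightarrow> 'e set \<Rightarrow> 'e set set" where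
  "facet_spanning v E I =
     {I' \<in> indep_sets v E. v ` I \<subseteq> span (v ` I') \<and> span (v ` I') \<in> facets v E}"

definition facet_normals ::
    "('e \<Rightarrow> real ^ 'n) \<Rightarrow> 'e set \<Rightarrow> ((real ^ 'n) set \<Rightarrow> real ^ 'n) \<Rightarrow> bool" where
  "facet_normals v E \<eta> \<longleftrightarrow> (\<forall>F\<in>facets v E. \<eta> F \<noteq> 0 \<and> (\<forall>x\<in>F. \<eta> F \<bullet> x = 0))"

definition minimal_in :: "'e set set \<Rightarrow> 'e set set" where
  "minimal_in J = {I \<in> J. \<not> (\<exists>I'\<in>J. I' \<subset> I)}"

definition completions :: "('e \<Rightarrow> real ^ 'n) \<Rightarrow> 'e set \<Rightarrow> 'e set \<Rightarrow> 'e set set" where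
  "completions v E I = {Z. Z \<subseteq> E \<and> I \<union> Z \<in> bases v E}"


section \<open>Ideals and polynomial spaces\<close>

text \<open>In the ideals below \<open>\<eta>\<close> is a choice of facet normals.\<close>

definition ideal_external ::
    "('e \<Rightarrow> real ^ 'n) \<Rightarrow> 'e set \<Rightarrow> ((real ^ 'n) set \<Rightarrow> real ^ 'n) \<Rightarrow> ('n::finite) cpoly set" where
  "ideal_external v E \<eta> =
     ideal_of {linear_poly (\<eta> F) ^ (card (outside v E F) + 1) | F. F \<in> facets v E}"

definition missing_spans :: "('e \<Rightarrow> real ^ 'n) \<Rightarrow> 'e set \<Rightarrow> 'e set set \<Rightarrow> (real ^ 'n) set set" where
  "missing_spans v E J = {span (v ` I) | I. I \<in> indep_sets v E - J}"

text \<open>Sums of ideals and of spaces of polynomials are elementwise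
  (\<^theory>\<open>HOL-Library.Set_Algebras\<close>).\<close>

definition ideal_semi_external ::
    "('e \<Rightarrow> real ^ 'n) \<Rightarrow> 'e set \<Rightarrow> 'e set set \<Rightarrow> ((real ^ 'n) set \<Rightarrow> real ^ 'n)
      \<Rightarrow> ('n::finite) cpoly set" where
  "ideal_semi_external v E J \<eta> =
     ideal_external v E \<eta> +
     ideal_of (\<Union>S\<in>missing_spans v E J. homogeneous_perp (card (outside v E S)) S)"

definition facet_eps :: "('e \<Rightarrow> real ^ 'n) \<Rightarrow> 'e set set \<Rightarrow> (real ^ 'n) set \<Rightarrow> nat" where
  "facet_eps v J F = (if \<exists>I\<in>J. F = span (v ` I) then 1 else 0)"

definition ideal_eps ::
    "('e \<Rightarrow> real ^ 'n) \<Rightarrow> 'e set \<Rightarrow> 'e set set \<Rightarrow> ((real ^ 'n) set \<Rightarrow> real ^ 'n)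
      \<Rightarrow> ('n::finite) cpoly set" where
  "ideal_eps v E J \<eta> =
     ideal_of {linear_poly (\<eta> F) ^ (card (outside v E F) + facet_eps v J F) | F. F \<in> facets v E}"

definition prod_poly :: "('e \<Rightarrow> real ^ 'n) \<Rightarrow> 'e set \<Rightarrow> ('n::finite) cpoly" where
  "prod_poly v Y = (\<Prod>e\<in>Y. linear_poly (v e))"

definition P_semi_external ::
    "('e \<Rightarrow> real ^ 'n) \<Rightarrow> 'e set \<Rightarrow> 'e set set \<Rightarrow> ('n::finite) cpoly set" where
  "P_semi_external v E J = cpoly_span {prod_poly v Y | Y. Y \<subseteq> E \<and> (\<exists>I\<in>J. Y \<inter> I = {})}"

definition P_central :: "('e \<Rightarrow> real ^ 'n) \<Rightarrow> 'e set \<Rightarrow> ('n::finite) cpoly set" where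
  "P_central v A = cpoly_span {prod_poly v Y | Y. Y \<subseteq> A \<and> dim (v ` (A - Y)) = CARD('n)}"

text \<open>The space \<open>P_central\<close> of the multiset union of \<open>E\<close> and \<open>Z\<close>: the labels form a disjoint sum,
  so that the multiplicities of vectors of \<open>Z\<close> add to those in \<open>E\<close>.\<close>

definition P_central_union ::
    "('e \<Rightarrow> real ^ 'n) \<Rightarrow> 'e set \<Rightarrow> 'e set \<Rightarrow> ('n::finite) cpoly set" where
  "P_central_union v E Z = P_central (case_sum v v) (E <+> Z)"

end

theory Submission
  imports Defs "HOL-Computational_Algebra.Polynomial"
begin

text \<open>
  Call \<open>e \<in> E\<close> orthogonal to \<open>\<zeta>\<close> if \<open>v e\<close> is. For a direction \<open>\<zeta>\<close> let \<open>m(\<zeta>)\<close> be the number of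
  elements of \<open>E\<close> that are not orthogonal to \<open>\<zeta>\<close>, and let \<open>\<epsilon>(\<zeta>)\<close> be \<open>1\<close> if some member of \<open>J\<close>
  consists of elements orthogonal to \<open>\<zeta>\<close>, and \<open>0\<close> otherwise. Write \<open>p_\<zeta>\<close> for the linear form of
  \<open>\<zeta>\<close>. Everything rests on the fact that the generators of \<open>ideal_eps\<close>, the powers
  \<open>p_\<zeta> ^ (m(\<zeta>) + \<epsilon>(\<zeta>))\<close> for facet normals \<open>\<zeta>\<close>, force the same powers for all directions.

  To see this, induct on \<open>m(\<zeta>)\<close>. Choose a facet containing all \<open>v e\<close> orthogonal to \<open>\<zeta>\<close>; the
  additional condition on \<open>J\<close> guarantees that it can be chosen with its \<open>\<epsilon>\<close> at most \<open>\<epsilon>(\<zeta>)\<close>.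
  Let \<open>\<xi>\<close> be its normal. Every \<open>e\<close> outside the facet is orthogonal to exactly one vector
  \<open>\<zeta> + c\<xi>\<close>, and for these finitely many \<open>c\<close> the induction hypothesis applies, because everything
  orthogonal to \<open>\<zeta>\<close> is orthogonal to \<open>\<xi>\<close> as well. If a linear functional
  \<open>l\<close> vanishes on the ideal, the powers known for \<open>\<zeta> + c\<xi>\<close> are zeros of high multiplicity of the
  univariate polynomial \<open>l((p_\<zeta> + z p_\<xi>)^M)\<close>, and the power known for \<open>\<xi>\<close> bounds its degree. With
  \<open>M = m(\<zeta>) + \<epsilon>(\<zeta>)\<close> there are more zeros than the degree permits, so the polynomial vanishes, and its
  value at \<open>0\<close> is \<open>l(p_\<zeta>^M)\<close>. Only commuting operators enter here (\<open>pencil_power_mem\<close>,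
  \<open>direction_power_mem\<close>), so the argument serves twice: for multiplication modulo the ideal, and for
  directional derivatives of a polynomial.

  The multiplication version gives the equality of ideals: by Euler's formula and polarisation,
  homogeneous polynomials on the complement of \<open>S\<close> are generated by powers \<open>p_\<zeta>^k\<close> with \<open>\<zeta>\<close>
  orthogonal to \<open>S\<close> (\<open>homogeneous_perp_subset\<close>), and for a missing span \<open>S\<close> all the powers with
  \<open>k\<close> the number of elements of \<open>E\<close> outside \<open>S\<close> are available.

  For the second equality the inclusion from left to right is immediate: if \<open>Y\<close> misses a minimal \<open>I\<close>,
  then \<open>Y\<close> leaves a full-rank complement in the union of \<open>E\<close> and \<open>Z\<close>,
  for each completion \<open>Z\<close> of \<open>I\<close>. Conversely, for each facet \<open>F\<close>
  there is a completion \<open>Z\<close> of \<open>I\<close> with at most \<open>\<epsilon>(F)\<close> elements outside \<open>F\<close>, so a member \<open>f\<close> of the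
  intersection has degree less than \<open>m(F) + \<epsilon>(F)\<close> along the normal of \<open>F\<close>. The derivative version
  extends these bounds to all directions, and then \<open>f\<close> lies in \<open>P_semi_external\<close> by deletion and
  contraction of the elements of \<open>E\<close> (\<open>mem_P_semi_external_if_line_degree_less\<close>): restrict \<open>f\<close> to the
  hyperplane orthogonal to \<open>x\<close>, subtract a member of the space with the same restriction, and divide
  by \<open>p_x\<close>.
\<close>

section \<open>The polynomial ring\<close>

text \<open>The interpretation of the ring as a module over itself makes the reverse of associativity a
  simplification rule, which does not terminate together with \<open>mult.assoc\<close>.\<close>

declare ideal.scale_scale [simp del]

lemma cpoly_eq_sum_monomials:
  fixes p :: "'n cpoly"
  shows "p = (\<Sum>m\<in>Poly_Mapping.keys p. Poly_Mapping.single m (Poly_Mapping.lookup p m))"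
proof (rule poly_mapping_eqI)
  fix k
  show "Poly_Mapping.lookup p k =
    Poly_Mapping.lookup (\<Sum>m\<in>Poly_Mapping.keys p. Poly_Mapping.single m (Poly_Mapping.lookup p m)) k"
    by (auto simp: lookup_sum lookup_single when_def in_keys_iff
        sum.delta[OF finite_keys, where a = k] cong: if_cong)
qed

lemma monomial_eq_sum_singles:
  fixes m :: "'n::finite \<Rightarrow>\<^sub>0 nat"
  shows "m = (\<Sum>i\<in>UNIV. Poly_Mapping.single i (Poly_Mapping.lookup m i))"
  by (rule poly_mapping_eqI) (simp add: lookup_sum lookup_single when_def)

lemma linear_poly_axis:
  "linear_poly (axis i 1) = (Poly_Mapping.single (Poly_Mapping.single i 1) 1 :: 'n::finite cpoly)"
proof -
  have "(\<Sum>j\<in>UNIV. Poly_Mapping.single (Poly_Mapping.single j 1) (complex_of_real (axis i 1 $ j))) =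
    (\<Sum>j\<in>UNIV. if j = i then (Poly_Mapping.single (Poly_Mapping.single i 1) 1 :: 'n cpoly) else 0)"
    by (rule sum.cong) (auto simp: axis_def)
  then show ?thesis
    unfolding linear_poly_def by simp
qed

text \<open>Induction along the construction of the ring: evaluation, differentiation and the other maps below
  are determined by their values on constants and variables and by their behaviour on sums and
  products.\<close>

lemma cpoly_induct [case_names const var add mult]:
  fixes p :: "'n::finite cpoly"
  assumes const: "\<And>c. P (Poly_Mapping.single 0 c)"
    and var: "\<And>i. P (linear_poly (axis i 1))"
    and add: "\<And>p q. P p \<Longrightarrow> P q \<Longrightarrow> P (p + q)"
    and mult: "\<And>p q. P p \<Longrightarrow> P q \<Longrightarrow> P (p * q)"
  shows "P p"
proof -
  have var_power: "P (Poly_Mapping.single (Poly_Mapping.single i k) 1)" for i k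
  proof (induction k)
    case 0
    then show ?case using const[of 1] by simp
  next
    case (Suc k)
    have "Poly_Mapping.single (Poly_Mapping.single i (Suc k)) (1::complex) =
      linear_poly (axis i 1) * Poly_Mapping.single (Poly_Mapping.single i k) 1"
      by (simp add: linear_poly_axis mult_single flip: single_add)
    then show ?case using mult[OF var Suc] by simp
  qed
  have monom: "P (Poly_Mapping.single (\<Sum>i\<in>A. Poly_Mapping.single i (Poly_Mapping.lookup m i)) 1)"
    if "finite A" for A m
    using that
  proof induction
    case empty
    then show ?case using const[of 1] by simp
  next
    case (insert i A)
    have "Poly_Mapping.single (\<Sum>i\<in>insert i A. Poly_Mapping.single i (Poly_Mapping.lookup m i)) (1::complex) =
      Poly_Mapping.single (Poly_Mapping.single i (Poly_Mapping.lookup m i)) 1 *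
      Poly_Mapping.single (\<Sum>i\<in>A. Poly_Mapping.single i (Poly_Mapping.lookup m i)) 1"
      using insert by (simp add: mult_single)
    then show ?case using mult[OF var_power insert.IH] by metis
  qed
  have single: "P (Poly_Mapping.single m c)" for m c
  proof -
    have "Poly_Mapping.single m c = Poly_Mapping.single 0 c * Poly_Mapping.single m 1"
      by (simp add: mult_single)
    then show ?thesis
      using mult[OF const monom[of UNIV m]] by (simp flip: monomial_eq_sum_singles)
  qed
  have "P (\<Sum>m\<in>A. Poly_Mapping.single m (Poly_Mapping.lookup p m))" if "finite A" for A
    using that by induction (use const[of 0] single add in auto)
  then show ?thesis
    by (subst cpoly_eq_sum_monomials) simp
qed

lemma poly_scale_mult_left: "poly_scale c (p * q) = poly_scale c p * q"
  and poly_scale_mult_right: "poly_scale c (p * q) = p * poly_scale c (q :: 'n cpoly)"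
  unfolding poly_scale_def by (rule mult.assoc[symmetric], rule mult.left_commute)

lemma lookup_poly_scale: "Poly_Mapping.lookup (poly_scale c p) m = c * Poly_Mapping.lookup p m"
  unfolding poly_scale_def mult_map_scale_conv_mult[symmetric]
  by (simp add: Poly_Mapping.map.rep_eq when_def)

lemma linear_poly_add: "linear_poly (x + y) = linear_poly x + (linear_poly y :: 'n::finite cpoly)"
  by (simp add: linear_poly_def single_add sum.distrib)

lemma linear_poly_scaleR: "linear_poly (r *\<^sub>R x) = poly_scale (complex_of_real r) (linear_poly x :: 'n::finite cpoly)"
  by (simp add: linear_poly_def poly_scale_def sum_distrib_left mult_single)

lemma linear_poly_eq_sum:
  "linear_poly x = (\<Sum>i\<in>UNIV. poly_scale (complex_of_real (x $ i)) (linear_poly (axis i 1) :: 'n::finite cpoly))"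
  by (simp add: linear_poly_axis linear_poly_def[of x] poly_scale_def mult_single)

section \<open>Derivatives\<close>

text \<open>Additivity, homogeneity and commutation of partial derivatives are read off from coefficients, where
  the sum over the support has disappeared.\<close>

lemma lookup_partial_deriv:
  fixes p :: "'n::finite cpoly"
  shows "Poly_Mapping.lookup (partial_deriv i p) m =
    of_nat (Poly_Mapping.lookup m i + 1) * Poly_Mapping.lookup p (m + Poly_Mapping.single i 1)"
proof -
  let ?e = "Poly_Mapping.single i (1::nat)"
  have eq: "(k - ?e = m \<and> Poly_Mapping.lookup k i \<noteq> 0) \<longleftrightarrow> k = m + ?e" for k
  proof
    assume *: "k - ?e = m \<and> Poly_Mapping.lookup k i \<noteq> 0"
    show "k = m + ?e"
      by (rule poly_mapping_eqI) (use * in \<open>auto simp: lookup_add lookup_minus lookup_single when_def\<close>)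
  qed (auto simp: lookup_add)
  have "Poly_Mapping.lookup (partial_deriv i p) m = (\<Sum>k\<in>Poly_Mapping.keys p.
      (of_nat (Poly_Mapping.lookup k i) * Poly_Mapping.lookup p k when k - ?e = m))"
    by (simp add: partial_deriv_def lookup_sum lookup_single)
  also have "\<dots> = (\<Sum>k\<in>Poly_Mapping.keys p. if k = m + ?e then
      of_nat (Poly_Mapping.lookup m i + 1) * Poly_Mapping.lookup p (m + ?e) else 0)"
  proof (rule sum.cong)
    fix k
    show "(of_nat (Poly_Mapping.lookup k i) * Poly_Mapping.lookup p k when k - ?e = m) =
      (if k = m + ?e then of_nat (Poly_Mapping.lookup m i + 1) * Poly_Mapping.lookup p (m + ?e) else 0)"
    proof (cases "k = m + ?e")
      case True
      then show ?thesis by (simp add: lookup_add)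
    next
      case False
      then have "k - ?e \<noteq> m \<or> Poly_Mapping.lookup k i = 0" using eq[of k] by blast
      then show ?thesis using False by (auto simp: when_def)
    qed
  qed simp
  also have "\<dots> = of_nat (Poly_Mapping.lookup m i + 1) * Poly_Mapping.lookup p (m + ?e)"
    by (auto simp: sum.delta[OF finite_keys] in_keys_iff)
  finally show ?thesis .
qed

lemma partial_deriv_add: "partial_deriv i (p + q) = partial_deriv i p + partial_deriv i (q :: 'n::finite cpoly)"
  by (rule poly_mapping_eqI) (simp add: lookup_partial_deriv lookup_add algebra_simps)

lemma partial_deriv_scale:
  "partial_deriv i (poly_scale c p) = poly_scale c (partial_deriv i (p :: 'n::finite cpoly))"
  by (rule poly_mapping_eqI) (simp only: lookup_partial_deriv lookup_poly_scale mult.left_commute)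

lemma partial_deriv_commute:
  "partial_deriv i (partial_deriv j p) = partial_deriv j (partial_deriv i (p :: 'n::finite cpoly))"
proof (cases "i = j")
  case False
  show ?thesis
  proof (rule poly_mapping_eqI)
    fix m
    have "m + Poly_Mapping.single i 1 + Poly_Mapping.single j 1 =
        m + Poly_Mapping.single j 1 + Poly_Mapping.single i (1::nat)"
      by (simp only: add_ac)
    then show "Poly_Mapping.lookup (partial_deriv i (partial_deriv j p)) m =
        Poly_Mapping.lookup (partial_deriv j (partial_deriv i p)) m"
      using False by (simp add: lookup_partial_deriv lookup_add lookup_single mult.left_commute)
  qed
qed simp

lemma partial_deriv_single:
  "partial_deriv i (Poly_Mapping.single m c :: 'n::finite cpoly) =
    Poly_Mapping.single (m - Poly_Mapping.single i 1) (of_nat (Poly_Mapping.lookup m i) * c)"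
  by (cases "c = 0") (simp_all add: partial_deriv_def)

lemma partial_deriv_0 [simp]: "partial_deriv i 0 = (0 :: 'n::finite cpoly)"
  by (simp add: partial_deriv_def)

lemma partial_deriv_sum:
  "partial_deriv i (sum f A) = (\<Sum>x\<in>A. partial_deriv i (f x :: 'n::finite cpoly))"
  by (induction A rule: infinite_finite_induct) (simp_all add: partial_deriv_add)

lemma partial_deriv_mult:
  "partial_deriv i (p * q) = partial_deriv i p * q + p * partial_deriv i (q :: 'n::finite cpoly)"
proof -
  let ?s = "Poly_Mapping.single :: _ \<Rightarrow> _ \<Rightarrow> 'n cpoly" and ?e = "Poly_Mapping.single i (1::nat)"
  have shift: "Poly_Mapping.lookup m i \<noteq> 0 \<Longrightarrow> m - ?e + k = m + k - ?e" for m k :: "'n \<Rightarrow>\<^sub>0 nat"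
    by (rule poly_mapping_eqI) (auto simp: lookup_add lookup_minus lookup_single when_def)
  have left: "?s (m - ?e + k) (of_nat (Poly_Mapping.lookup m i) * c) =
      ?s (m + k - ?e) (of_nat (Poly_Mapping.lookup m i) * c)" for m k c
    by (cases "Poly_Mapping.lookup m i = 0") (simp_all add: shift[simplified])
  have right: "?s (m + (k - ?e)) (of_nat (Poly_Mapping.lookup k i) * c) =
      ?s (m + k - ?e) (of_nat (Poly_Mapping.lookup k i) * c)" for m k c
    using left[of k m c] by (simp only: add.commute)
  have single: "partial_deriv i (?s m a * ?s k b) =
      partial_deriv i (?s m a) * ?s k b + ?s m a * partial_deriv i (?s k b)" for m k a b
  proof -
    have "partial_deriv i (?s m a) * ?s k b = ?s (m + k - ?e) (of_nat (Poly_Mapping.lookup m i) * (a * b))"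
      by (simp only: partial_deriv_single mult_single left mult.assoc)
    moreover have "?s m a * partial_deriv i (?s k b) =
        ?s (m + k - ?e) (of_nat (Poly_Mapping.lookup k i) * (a * b))"
      by (simp only: partial_deriv_single mult_single right mult.left_commute[of a])
    moreover have "partial_deriv i (?s m a * ?s k b) =
        ?s (m + k - ?e) (of_nat (Poly_Mapping.lookup m i) * (a * b) + of_nat (Poly_Mapping.lookup k i) * (a * b))"
      by (simp only: partial_deriv_single mult_single lookup_add of_nat_add distrib_right)
    ultimately show ?thesis by (simp only: single_add)
  qed
  have single': "partial_deriv i (?s m a * q) =
      partial_deriv i (?s m a) * q + ?s m a * partial_deriv i q" for m a
  proof -
    have "partial_deriv i (?s m a * sum f B) =
        partial_deriv i (?s m a) * sum f B + ?s m a * partial_deriv i (sum f B)"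
      if "\<And>k. k \<in> B \<Longrightarrow> f k = ?s k (Poly_Mapping.lookup q k)" for f B
      using that by (simp add: partial_deriv_sum single sum_distrib_left sum.distrib)
    from this[of "Poly_Mapping.keys q" "\<lambda>k. ?s k (Poly_Mapping.lookup q k)"] show ?thesis
      by (simp flip: cpoly_eq_sum_monomials)
  qed
  have "partial_deriv i (sum f B * q) = partial_deriv i (sum f B) * q + sum f B * partial_deriv i q"
    if "\<And>k. k \<in> B \<Longrightarrow> f k = ?s k (Poly_Mapping.lookup p k)" for f B
    using that by (simp add: partial_deriv_sum single' sum_distrib_right sum.distrib)
  from this[of "Poly_Mapping.keys p" "\<lambda>k. ?s k (Poly_Mapping.lookup p k)"] show ?thesis
    by (simp flip: cpoly_eq_sum_monomials)
qed

lemma dir_deriv_add: "dir_deriv \<eta> (p + q) = dir_deriv \<eta> p + dir_deriv \<eta> q"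
  by (simp add: dir_deriv_def partial_deriv_add cpoly.scale_right_distrib sum.distrib)

lemma dir_deriv_scale: "dir_deriv \<eta> (poly_scale c p) = poly_scale c (dir_deriv \<eta> p)"
  by (simp add: dir_deriv_def partial_deriv_scale cpoly.scale_sum_right mult.commute)

lemma dir_deriv_0 [simp]: "dir_deriv \<eta> 0 = 0"
  by (simp add: dir_deriv_def)

lemma dir_deriv_mult: "dir_deriv \<eta> (p * q) = dir_deriv \<eta> p * q + p * dir_deriv \<eta> q"
  by (simp add: dir_deriv_def partial_deriv_mult cpoly.scale_right_distrib sum.distrib
      sum_distrib_left sum_distrib_right poly_scale_mult_left flip: poly_scale_mult_right)

lemma dir_deriv_sum: "dir_deriv \<eta> (sum f A) = (\<Sum>x\<in>A. dir_deriv \<eta> (f x))"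
  by (induction A rule: infinite_finite_induct) (simp_all add: dir_deriv_add)

lemma dir_deriv_partial_deriv:
  "dir_deriv \<eta> (partial_deriv i p) = partial_deriv i (dir_deriv \<eta> p)"
  by (simp add: dir_deriv_def partial_deriv_sum partial_deriv_scale partial_deriv_commute[of i])

lemma dir_deriv_commute: "dir_deriv \<eta> (dir_deriv \<zeta> p) = dir_deriv \<zeta> (dir_deriv \<eta> p)"
  by (subst (1 4) dir_deriv_def) (simp add: dir_deriv_sum dir_deriv_scale dir_deriv_partial_deriv)

lemma dir_deriv_vec_add: "dir_deriv (\<eta> + \<zeta>) p = dir_deriv \<eta> p + dir_deriv \<zeta> p"
  by (simp add: dir_deriv_def cpoly.scale_left_distrib sum.distrib)

lemma dir_deriv_vec_scaleR: "dir_deriv (r *\<^sub>R \<eta>) p = poly_scale (complex_of_real r) (dir_deriv \<eta> p)"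
  by (simp add: dir_deriv_def cpoly.scale_sum_right)

lemma dir_deriv_axis: "dir_deriv (axis i 1) p = partial_deriv i p"
proof -
  have "dir_deriv (axis i 1) p = (\<Sum>j\<in>UNIV. if j = i then partial_deriv i p else 0)"
    unfolding dir_deriv_def by (rule sum.cong) (auto simp: axis_def)
  then show ?thesis by simp
qed

lemma dir_deriv_const: "dir_deriv \<eta> (Poly_Mapping.single 0 c) = 0"
  by (simp add: dir_deriv_def partial_deriv_single)

lemma dir_deriv_linear_poly:
  "dir_deriv \<eta> (linear_poly x) = Poly_Mapping.single 0 (complex_of_real (\<eta> \<bullet> x))"
proof -
  have single_sum: "Poly_Mapping.single 0 (sum f A) = (\<Sum>a\<in>A. Poly_Mapping.single 0 (f a) :: 'a cpoly)"
    for f :: "'a::finite \<Rightarrow> complex" and A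
    by (induction A rule: infinite_finite_induct) (simp_all add: single_add)
  have "partial_deriv i (linear_poly x) = Poly_Mapping.single 0 (complex_of_real (x $ i))" for i
  proof -
    have "partial_deriv i (linear_poly x) =
      (\<Sum>j\<in>UNIV. if j = i then Poly_Mapping.single 0 (complex_of_real (x $ i)) else 0)"
      unfolding linear_poly_def partial_deriv_sum partial_deriv_single
      by (rule sum.cong) (auto simp: lookup_single when_def)
    then show ?thesis by simp
  qed
  then show ?thesis
    by (simp add: dir_deriv_def poly_scale_def mult_single inner_vec_def single_sum)
qed

lemma dir_deriv_linear_poly_power:
  "dir_deriv \<zeta> (linear_poly \<eta> ^ k) =
    poly_scale (of_nat k * complex_of_real (\<zeta> \<bullet> \<eta>)) (linear_poly \<eta> ^ (k - 1))"
proof (induction k)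
  case 0
  show ?case using dir_deriv_const[of \<zeta> 1] by simp
next
  case (Suc k)
  have "dir_deriv \<zeta> (linear_poly \<eta> ^ Suc k) =
      poly_scale (complex_of_real (\<zeta> \<bullet> \<eta>)) (linear_poly \<eta> ^ k) +
      poly_scale (of_nat k * complex_of_real (\<zeta> \<bullet> \<eta>)) (linear_poly \<eta> * linear_poly \<eta> ^ (k - 1))"
    by (simp only: power_Suc dir_deriv_mult Suc dir_deriv_linear_poly poly_scale_mult_right
        flip: poly_scale_def)
  also have "\<dots> = poly_scale (of_nat (Suc k) * complex_of_real (\<zeta> \<bullet> \<eta>)) (linear_poly \<eta> ^ k)"
  proof (cases k)
    case (Suc l)
    then have "linear_poly \<eta> * linear_poly \<eta> ^ (k - 1) = linear_poly \<eta> ^ k"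
      by simp
    then show ?thesis
      by (simp only: flip: cpoly.scale_left_distrib) (simp add: distrib_right)
  qed simp
  finally show ?case by simp
qed

section \<open>Homogeneous polynomials\<close>

lemma homogeneous_add: "p \<in> homogeneous k \<Longrightarrow> q \<in> homogeneous k \<Longrightarrow> p + q \<in> homogeneous k"
  using keys_add[of p q] by (auto simp: homogeneous_def)

lemma homogeneous_0 [simp]: "0 \<in> homogeneous k"
  by (simp add: homogeneous_def)

lemma homogeneous_sum: "(\<And>x. x \<in> A \<Longrightarrow> f x \<in> homogeneous k) \<Longrightarrow> sum f A \<in> homogeneous k"
  by (induction A rule: infinite_finite_induct) (auto intro: homogeneous_add)

lemma homogeneous_mult: "p \<in> homogeneous k \<Longrightarrow> q \<in> homogeneous l \<Longrightarrow> p * q \<in> homogeneous (k + l)"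
  using keys_mult[of p q] by (fastforce simp: homogeneous_def lookup_add sum.distrib)

lemma homogeneous_linear_poly: "linear_poly x \<in> homogeneous 1"
  unfolding linear_poly_def
  by (rule homogeneous_sum) (auto simp: homogeneous_def lookup_single when_def split: if_splits)

lemma homogeneous_linear_poly_power: "linear_poly x ^ k \<in> homogeneous k"
proof (induction k)
  case 0
  show ?case by (simp add: homogeneous_def)
next
  case (Suc k)
  then show ?case using homogeneous_mult[OF homogeneous_linear_poly Suc] by simp
qed

lemma homogeneous_partial_deriv:
  assumes "p \<in> homogeneous (Suc k)"
  shows "partial_deriv i p \<in> homogeneous k"
proof -
  have "(\<Sum>j\<in>UNIV. Poly_Mapping.lookup m j) = k" if "m \<in> Poly_Mapping.keys (partial_deriv i p)" for m
  proof -
    have "m + Poly_Mapping.single i 1 \<in> Poly_Mapping.keys p"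
      using that by (auto simp: in_keys_iff lookup_partial_deriv)
    then have "(\<Sum>j\<in>UNIV. Poly_Mapping.lookup (m + Poly_Mapping.single i 1) j) = Suc k"
      using assms by (auto simp: homogeneous_def)
    then show ?thesis
      by (simp add: lookup_add sum.distrib lookup_single when_def)
  qed
  then show ?thesis by (auto simp: homogeneous_def)
qed

text \<open>Euler's formula holds monomial by monomial, since the exponents of a monomial sum up to \<open>k\<close>.\<close>

lemma euler_homogeneous:
  assumes "p \<in> homogeneous k"
  shows "poly_scale (of_nat k) p = (\<Sum>i\<in>UNIV. linear_poly (axis i 1) * partial_deriv i p)"
proof -
  have "linear_poly (axis i 1) * partial_deriv i p = (\<Sum>m\<in>Poly_Mapping.keys p.
      Poly_Mapping.single m (of_nat (Poly_Mapping.lookup m i) * Poly_Mapping.lookup p m))" for i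
  proof -
    have shift: "Poly_Mapping.lookup m i \<noteq> 0 \<Longrightarrow>
        Poly_Mapping.single i 1 + (m - Poly_Mapping.single i 1) = m" for m :: "'a \<Rightarrow>\<^sub>0 nat"
      by (rule poly_mapping_eqI) (auto simp: lookup_add lookup_minus lookup_single when_def)
    have "Poly_Mapping.single (Poly_Mapping.single i 1 + (m - Poly_Mapping.single i 1)) (of_nat (Poly_Mapping.lookup m i) * Poly_Mapping.lookup p m) =
      Poly_Mapping.single m (of_nat (Poly_Mapping.lookup m i) * Poly_Mapping.lookup p m)" for m
      by (cases "Poly_Mapping.lookup m i = 0") (use shift[of m] in auto)
    then show ?thesis
      by (simp add: linear_poly_axis partial_deriv_def sum_distrib_left mult_single)
  qed
  then have "(\<Sum>i\<in>UNIV. linear_poly (axis i 1) * partial_deriv i p) = (\<Sum>m\<in>Poly_Mapping.keys p.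
      \<Sum>i\<in>UNIV. Poly_Mapping.single m (of_nat (Poly_Mapping.lookup m i) * Poly_Mapping.lookup p m))"
    by (simp add: sum.swap[of _ UNIV])
  also have "\<dots> = (\<Sum>m\<in>Poly_Mapping.keys p. Poly_Mapping.single m (of_nat k * Poly_Mapping.lookup p m))"
  proof (rule sum.cong)
    fix m assume "m \<in> Poly_Mapping.keys p"
    then have "(\<Sum>i\<in>UNIV. Poly_Mapping.lookup m i) = k"
      using assms by (auto simp: homogeneous_def)
    moreover have "(\<Sum>i\<in>A. Poly_Mapping.single m (of_nat (Poly_Mapping.lookup m i) * Poly_Mapping.lookup p m)) =
      Poly_Mapping.single m (of_nat (\<Sum>i\<in>A. Poly_Mapping.lookup m i) * Poly_Mapping.lookup p m)" for A
      by (induction A rule: infinite_finite_induct) (simp_all add: distrib_right flip: single_add)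
    ultimately show "(\<Sum>i\<in>UNIV. Poly_Mapping.single m (of_nat (Poly_Mapping.lookup m i) * Poly_Mapping.lookup p m)) =
      Poly_Mapping.single m (of_nat k * Poly_Mapping.lookup p m)" by metis
  qed simp
  also have "\<dots> = poly_scale (of_nat k) p"
  proof -
    have "poly_scale (of_nat k) (\<Sum>m\<in>B. Poly_Mapping.single m (Poly_Mapping.lookup p m)) =
      (\<Sum>m\<in>B. Poly_Mapping.single m (of_nat k * Poly_Mapping.lookup p m))" for B
      by (simp only: poly_scale_def sum_distrib_left mult_single add_0)
    from this[of "Poly_Mapping.keys p"] show ?thesis
      by (simp flip: cpoly_eq_sum_monomials)
  qed
  finally show ?thesis by simp
qed

section \<open>Polynomials along lines\<close>

text \<open>The restriction of a polynomial to the line \<open>z \<mapsto> t + z \<eta>\<close>. Degrees along lines replace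
  iterated directional derivatives: they make sense on subspaces, to which polynomials are
  restricted later without changing the number of variables.\<close>

definition line :: "real ^ 'n \<Rightarrow> real ^ 'n \<Rightarrow> 'n::finite cpoly \<Rightarrow> complex poly" where
  "line t \<eta> p = (\<Sum>m\<in>Poly_Mapping.keys p. smult (Poly_Mapping.lookup p m)
     (\<Prod>i\<in>UNIV. [:complex_of_real (t $ i), complex_of_real (\<eta> $ i):] ^ Poly_Mapping.lookup m i))"

definition value_at :: "real ^ 'n \<Rightarrow> 'n::finite cpoly \<Rightarrow> complex" where
  "value_at t p = poly (line t 0 p) 0"

lemma line_superset:
  assumes "finite A" "Poly_Mapping.keys p \<subseteq> A"
  shows "line t \<eta> p = (\<Sum>m\<in>A. smult (Poly_Mapping.lookup p m)
     (\<Prod>i\<in>UNIV. [:complex_of_real (t $ i), complex_of_real (\<eta> $ i):] ^ Poly_Mapping.lookup m i))"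
  unfolding line_def
  by (rule sum.mono_neutral_left) (use assms in \<open>auto simp: in_keys_iff\<close>)

lemma line_add: "line t \<eta> (p + q) = line t \<eta> p + line t \<eta> q"
proof -
  let ?A = "Poly_Mapping.keys p \<union> Poly_Mapping.keys q"
  have "finite ?A" "Poly_Mapping.keys (p + q) \<subseteq> ?A" "Poly_Mapping.keys p \<subseteq> ?A" "Poly_Mapping.keys q \<subseteq> ?A"
    using keys_add[of p q] by auto
  then show ?thesis
    by (simp add: line_superset[of ?A] lookup_add smult_add_left sum.distrib)
qed

lemma line_0 [simp]: "line t \<eta> 0 = 0"
  by (simp add: line_def)

lemma line_sum: "line t \<eta> (sum f A) = (\<Sum>a\<in>A. line t \<eta> (f a))"
  by (induction A rule: infinite_finite_induct) (simp_all add: line_add)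

lemma line_single:
  "line t \<eta> (Poly_Mapping.single m c) = smult c
    (\<Prod>i\<in>UNIV. [:complex_of_real (t $ i), complex_of_real (\<eta> $ i):] ^ Poly_Mapping.lookup m i)"
  by (cases "c = 0") (simp_all add: line_def)

lemma line_const: "line t \<eta> (Poly_Mapping.single 0 c) = [:c:]"
  by (simp add: line_single)

lemma line_1 [simp]: "line t \<eta> 1 = 1"
  using line_const[of t \<eta> 1] by simp

lemma line_mult: "line t \<eta> (p * q) = line t \<eta> p * line t \<eta> q"
proof -
  let ?s = "Poly_Mapping.single :: _ \<Rightarrow> _ \<Rightarrow> 'a cpoly"
  have single: "line t \<eta> (?s m a * ?s k b) = line t \<eta> (?s m a) * line t \<eta> (?s k b)" for m a k b
    by (simp add: mult_single line_single lookup_add power_add prod.distrib mult.commute[of b a])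
  have single': "line t \<eta> (?s m a * q) = line t \<eta> (?s m a) * line t \<eta> q" for m a
  proof -
    have "line t \<eta> (?s m a * sum f B) = line t \<eta> (?s m a) * line t \<eta> (sum f B)"
      if "\<And>k. k \<in> B \<Longrightarrow> f k = ?s k (Poly_Mapping.lookup q k)" for f B
      using that by (simp add: line_sum single sum_distrib_left)
    from this[of "Poly_Mapping.keys q" "\<lambda>k. ?s k (Poly_Mapping.lookup q k)"] show ?thesis
      by (simp flip: cpoly_eq_sum_monomials)
  qed
  have "line t \<eta> (sum f B * q) = line t \<eta> (sum f B) * line t \<eta> q"
    if "\<And>k. k \<in> B \<Longrightarrow> f k = ?s k (Poly_Mapping.lookup p k)" for f B
    using that by (simp add: line_sum single' sum_distrib_right)
  from this[of "Poly_Mapping.keys p" "\<lambda>k. ?s k (Poly_Mapping.lookup p k)"] show ?thesis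
    by (simp flip: cpoly_eq_sum_monomials)
qed

lemma line_prod: "line t \<eta> (prod f A) = (\<Prod>a\<in>A. line t \<eta> (f a))"
  by (induction A rule: infinite_finite_induct) (simp_all add: line_mult)

lemma line_scale: "line t \<eta> (poly_scale c p) = smult c (line t \<eta> p)"
  by (simp add: poly_scale_def line_mult line_const)

lemma line_var:
  "line t \<eta> (linear_poly (axis i 1)) = [:complex_of_real (t $ i), complex_of_real (\<eta> $ i):]"
proof -
  have "(\<Prod>j\<in>UNIV. [:complex_of_real (t $ j), complex_of_real (\<eta> $ j):] ^
        Poly_Mapping.lookup (Poly_Mapping.single i (1::nat)) j) =
      (\<Prod>j\<in>UNIV. if j = i then [:complex_of_real (t $ i), complex_of_real (\<eta> $ i):] else 1)"
    by (rule prod.cong) (auto simp: lookup_single when_def)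
  then show ?thesis
    by (simp add: linear_poly_axis line_single)
qed

lemma line_linear_poly:
  "line t \<eta> (linear_poly x) = [:complex_of_real (x \<bullet> t), complex_of_real (x \<bullet> \<eta>):]"
proof -
  have sum_pCons: "(\<Sum>i\<in>A. [:f i, g i:]) = [:\<Sum>i\<in>A. f i, \<Sum>i\<in>A. g i:]" for f g :: "'a \<Rightarrow> complex" and A
    by (induction A rule: infinite_finite_induct) simp_all
  show ?thesis
    by (subst linear_poly_eq_sum) (simp add: line_sum line_scale line_var inner_vec_def sum_pCons)
qed

lemma value_at_0 [simp]: "value_at t 0 = 0"
  and value_at_1 [simp]: "value_at t 1 = 1"
  and value_at_const: "value_at t (Poly_Mapping.single 0 c) = c"
  and value_at_add: "value_at t (p + q) = value_at t p + value_at t q"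
  and value_at_mult: "value_at t (p * q) = value_at t p * value_at t q"
  and value_at_scale: "value_at t (poly_scale c p) = c * value_at t p"
  and value_at_linear_poly: "value_at t (linear_poly x) = complex_of_real (x \<bullet> t)"
  by (simp_all add: value_at_def line_const line_add line_mult line_scale line_linear_poly)

lemma value_at_sum: "value_at t (sum f A) = (\<Sum>a\<in>A. value_at t (f a))"
  by (simp add: value_at_def line_sum poly_sum)

lemma value_at_uminus: "value_at t (- p) = - value_at t p"
  using value_at_add[of t p "- p"] by (simp add: eq_neg_iff_add_eq_0 add.commute)

lemma value_at_diff: "value_at t (p - q) = value_at t p - value_at t q"
  using value_at_add[of t p "- q"] by (simp add: value_at_uminus)

lemma line_diff: "line t \<eta> (p - q) = line t \<eta> p - line t \<eta> q"
  using line_add[of t \<eta> "p - q" q] by simp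

lemma poly_line: "poly (line t \<eta> p) (complex_of_real z) = value_at (t + z *\<^sub>R \<eta>) p"
  by (induction p rule: cpoly_induct)
    (simp_all add: line_const value_at_const line_linear_poly value_at_linear_poly inner_add_right
      line_add value_at_add line_mult value_at_mult)

text \<open>The chain rule.\<close>

lemma pderiv_line: "pderiv (line t \<eta> p) = line t \<eta> (dir_deriv \<eta> p)"
  by (induction p rule: cpoly_induct)
    (simp_all add: line_const dir_deriv_const line_linear_poly dir_deriv_linear_poly pderiv_pCons
      line_add dir_deriv_add pderiv_add line_mult dir_deriv_mult pderiv_mult inner_commute)

lemma higher_pderiv_line: "(pderiv ^^ k) (line t \<eta> p) = line t \<eta> ((dir_deriv \<eta> ^^ k) p)"
  by (induction k) (simp_all add: pderiv_line)

text \<open>The exception \<open>s = 0\<close> is what allows passing to the limit in \<open>line_degree_less_limit\<close>.\<close>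

lemma poly_eq_0_if_real_zeros:
  fixes q :: "complex poly"
  assumes "\<And>s::real. s \<noteq> 0 \<Longrightarrow> poly q (complex_of_real s) = 0"
  shows "q = 0"
proof (rule ccontr)
  assume "q \<noteq> 0"
  then have "finite {z. poly q z = 0}" by (rule poly_roots_finite)
  moreover have "complex_of_real ` {0<..<1} \<subseteq> {z. poly q z = 0}"
    using assms by auto
  ultimately have "finite (complex_of_real ` {0<..<1})" by (rule rev_finite_subset)
  then have "finite {0<..<(1::real)}" by (rule finite_imageD) (simp add: inj_on_def)
  then show False using infinite_Ioo[of 0 "1::real"] by simp
qed

text \<open>A polynomial vanishing at every point has derivatives that vanish at every point, and iterated
  derivatives reduce each coefficient to a constant coefficient, which is the value at \<open>0\<close>.\<close>

lemma value_at_eq_0_imp_0: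
  fixes p :: "'n::finite cpoly"
  assumes "\<And>t. value_at t p = 0"
  shows "p = 0"
proof -
  have deriv: "value_at t (partial_deriv i q) = 0" if "\<And>t. value_at t q = 0" for q :: "'n cpoly" and i t
  proof -
    have "line t (axis i 1) q = 0"
      by (rule poly_eq_0_if_real_zeros) (simp add: poly_line that)
    then have "line t (axis i 1) (partial_deriv i q) = 0"
      using pderiv_line[of t "axis i 1" q] by (simp add: dir_deriv_axis)
    then show ?thesis
      using poly_line[of t "axis i 1" "partial_deriv i q" 0] by simp
  qed
  have "\<forall>p. (\<forall>t. value_at t p = 0) \<longrightarrow> Poly_Mapping.lookup p m = 0"
    if "(\<Sum>i\<in>UNIV. Poly_Mapping.lookup m i) = k" for m :: "'n \<Rightarrow>\<^sub>0 nat" and k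
    using that
  proof (induction k arbitrary: m)
    case 0
    then have m: "m = 0" by (intro poly_mapping_eqI) simp
    have "value_at 0 p = Poly_Mapping.lookup p 0" for p :: "'n cpoly"
    proof -
      have "value_at 0 (Poly_Mapping.single m c) = (c when m = 0)" for m :: "'n \<Rightarrow>\<^sub>0 nat" and c
      proof (cases "m = 0")
        case False
        then obtain i where "Poly_Mapping.lookup m i \<noteq> 0"
          using poly_mapping_eqI[of m 0] by auto
        then have "(\<Prod>i\<in>UNIV. (0::complex poly) ^ Poly_Mapping.lookup m i) = 0"
          by (intro prod_zero) auto
        moreover have "value_at 0 (Poly_Mapping.single m c) =
            poly (smult c (\<Prod>i\<in>UNIV. (0::complex poly) ^ Poly_Mapping.lookup m i)) 0"
          by (simp add: value_at_def line_single)
        ultimately show ?thesis using False by (simp only: smult_0_right poly_0) simp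
      qed (simp add: value_at_const)
      then have "value_at 0 (\<Sum>m\<in>B. Poly_Mapping.single m (Poly_Mapping.lookup p m)) =
          Poly_Mapping.lookup (\<Sum>m\<in>B. Poly_Mapping.single m (Poly_Mapping.lookup p m)) 0" for B
        by (simp add: value_at_sum lookup_sum lookup_single)
      from this[of "Poly_Mapping.keys p"] show ?thesis
        by (simp flip: cpoly_eq_sum_monomials)
    qed
    then show ?case using m by metis
  next
    case (Suc k)
    then obtain i where i: "Poly_Mapping.lookup m i \<noteq> 0"
      by (metis sum.neutral nat.distinct(1))
    define m' where "m' = m - Poly_Mapping.single i 1"
    have m: "m = m' + Poly_Mapping.single i 1"
      unfolding m'_def
      by (rule poly_mapping_eqI) (use i in \<open>auto simp: lookup_add lookup_minus lookup_single when_def\<close>)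
    have "(\<Sum>j\<in>UNIV. Poly_Mapping.lookup m' j) = k"
      using Suc.prems unfolding m by (simp add: lookup_add sum.distrib lookup_single when_def)
    note IH = Suc.IH[OF this]
    show ?case
    proof (intro allI impI)
      fix p :: "'n cpoly" assume "\<forall>t. value_at t p = 0"
      then have "\<forall>t. value_at t (partial_deriv i p) = 0" using deriv by blast
      then have "Poly_Mapping.lookup (partial_deriv i p) m' = 0" using IH by blast
      then have "of_nat (Suc (Poly_Mapping.lookup m' i)) * Poly_Mapping.lookup p m = 0"
        by (simp only: lookup_partial_deriv m Suc_eq_plus1)
      then show "Poly_Mapping.lookup p m = 0"
        by (simp only: mult_eq_0_iff of_nat_eq_0_iff) simp
    qed
  qed
  then show ?thesis
    using assms by (intro poly_mapping_eqI) auto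
qed

definition line_degree_less :: "'n::finite cpoly \<Rightarrow> real ^ 'n \<Rightarrow> real ^ 'n \<Rightarrow> nat \<Rightarrow> bool" where
  "line_degree_less f t \<eta> k \<longleftrightarrow> (\<forall>i\<ge>k. coeff (line t \<eta> f) i = 0)"

text \<open>By Taylor's formula the coefficients of the restriction to a line are the iterated derivatives, up
  to factorials.\<close>

lemma higher_dir_deriv_eq_0_iff:
  "(dir_deriv \<eta> ^^ k) f = 0 \<longleftrightarrow> (\<forall>t. line_degree_less f t \<eta> k)"
proof
  assume "(dir_deriv \<eta> ^^ k) f = 0"
  show "\<forall>t. line_degree_less f t \<eta> k"
    unfolding line_degree_less_def
  proof (intro allI impI)
    fix t i assume "k \<le> i"
    have "coeff ((pderiv ^^ k) (line t \<eta> f)) (i - k) = 0"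
      using \<open>(dir_deriv \<eta> ^^ k) f = 0\<close> by (simp add: higher_pderiv_line)
    then have "pochhammer (of_nat (Suc (i - k)) :: complex) k * coeff (line t \<eta> f) i = 0"
      using \<open>k \<le> i\<close> unfolding coeff_higher_pderiv by (simp only: le_add_diff_inverse2)
    moreover have "pochhammer (of_nat (Suc (i - k)) :: complex) k \<noteq> 0"
      using pochhammer_pos[of "Suc (i - k)" k] by (simp add: pochhammer_of_nat del: of_nat_Suc)
    ultimately show "coeff (line t \<eta> f) i = 0" by simp
  qed
next
  assume *: "\<forall>t. line_degree_less f t \<eta> k"
  have "value_at t ((dir_deriv \<eta> ^^ k) f) = 0" for t
  proof -
    have "(pderiv ^^ k) (line t \<eta> f) = 0"
      using * by (intro poly_eqI) (simp add: coeff_higher_pderiv line_degree_less_def)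
    then show ?thesis
      using poly_line[of t \<eta> "(dir_deriv \<eta> ^^ k) f" 0] by (simp add: higher_pderiv_line)
  qed
  then show "(dir_deriv \<eta> ^^ k) f = 0" by (rule value_at_eq_0_imp_0)
qed

text \<open>The coefficients of the restriction are polynomial in the parameter \<open>s\<close>, so a coefficient that
  vanishes for all \<open>s \<noteq> 0\<close> also vanishes for \<open>s = 0\<close>. This moves degree bounds from points and
  directions in general position to special ones.\<close>

lemma line_degree_less_limit:
  assumes "\<And>s. s \<noteq> 0 \<Longrightarrow> line_degree_less f (t + s *\<^sub>R u) (\<eta> + s *\<^sub>R y) k"
  shows "line_degree_less f t \<eta> k"
proof -
  have "\<exists>q. \<forall>s i. coeff (line (t + s *\<^sub>R u) (\<eta> + s *\<^sub>R y) f) i = poly (q i) (complex_of_real s)" for f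
  proof (induction f rule: cpoly_induct)
    case (const c)
    show ?case
      by (rule exI[of _ "\<lambda>i. [:coeff [:c:] i:]"]) (simp add: line_const)
  next
    case (var i)
    show ?case
      by (rule exI[of _ "\<lambda>j. case j of 0 \<Rightarrow> [:of_real (t $ i), of_real (u $ i):]
          | Suc j \<Rightarrow> (if j = 0 then [:of_real (\<eta> $ i), of_real (y $ i):] else 0)"])
        (auto simp: line_linear_poly inner_axis' coeff_pCons split: nat.splits)
  next
    case (add p q)
    then obtain P Q where "\<forall>s i. coeff (line (t + s *\<^sub>R u) (\<eta> + s *\<^sub>R y) p) i = poly (P i) (complex_of_real s)"
      "\<forall>s i. coeff (line (t + s *\<^sub>R u) (\<eta> + s *\<^sub>R y) q) i = poly (Q i) (complex_of_real s)" by blast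
    then show ?case
      by (intro exI[of _ "\<lambda>i. P i + Q i"]) (simp add: line_add)
  next
    case (mult p q)
    then obtain P Q where "\<forall>s i. coeff (line (t + s *\<^sub>R u) (\<eta> + s *\<^sub>R y) p) i = poly (P i) (complex_of_real s)"
      "\<forall>s i. coeff (line (t + s *\<^sub>R u) (\<eta> + s *\<^sub>R y) q) i = poly (Q i) (complex_of_real s)" by blast
    then show ?case
      by (intro exI[of _ "\<lambda>i. \<Sum>j\<le>i. P j * Q (i - j)"]) (simp add: line_mult coeff_mult poly_sum)
  qed
  then obtain q where q: "\<And>s i. coeff (line (t + s *\<^sub>R u) (\<eta> + s *\<^sub>R y) f) i = poly (q i) (complex_of_real s)"
    by blast
  have "q i = 0" if "k \<le> i" for i
    by (rule poly_eq_0_if_real_zeros) (use assms that q in \<open>auto simp: line_degree_less_def\<close>)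
  then show ?thesis
    using q[of 0] by (simp add: line_degree_less_def)
qed

text \<open>If \<open>x \<bullet> u = 1\<close>, then \<open>t \<mapsto> t - (x \<bullet> t) u\<close> is a projection onto the hyperplane
  \<open>x \<bullet> t = 0\<close>, so a polynomial vanishing on that hyperplane is divisible by the linear form of
  \<open>x\<close>. As a statement about differences of values, divisibility is stable under sums and products.\<close>

lemma divide_by_linear:
  fixes f :: "'n::finite cpoly"
  obtains h where "\<And>t. value_at t f - value_at (t - (x \<bullet> t) *\<^sub>R u) f = complex_of_real (x \<bullet> t) * value_at t h"
proof -
  have "\<exists>h. \<forall>t. value_at t f - value_at (t - (x \<bullet> t) *\<^sub>R u) f = complex_of_real (x \<bullet> t) * value_at t h"
  proof (induction f rule: cpoly_induct)
    case (const c)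
    show ?case by (rule exI[of _ 0]) (simp add: value_at_const)
  next
    case (var i)
    show ?case
      by (rule exI[of _ "Poly_Mapping.single 0 (of_real (u $ i))"])
        (simp add: value_at_const value_at_linear_poly inner_axis')
  next
    case (add p q)
    then obtain g h where "\<forall>t. value_at t p - value_at (t - (x \<bullet> t) *\<^sub>R u) p = complex_of_real (x \<bullet> t) * value_at t g"
      "\<forall>t. value_at t q - value_at (t - (x \<bullet> t) *\<^sub>R u) q = complex_of_real (x \<bullet> t) * value_at t h" by blast
    then show ?case
      by (intro exI[of _ "g + h"]) (simp add: value_at_add distrib_left add_diff_add)
  next
    case (mult p q)
    then obtain g h where gh: "\<And>t. value_at t p - value_at (t - (x \<bullet> t) *\<^sub>R u) p = complex_of_real (x \<bullet> t) * value_at t g"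
      "\<And>t. value_at t q - value_at (t - (x \<bullet> t) *\<^sub>R u) q = complex_of_real (x \<bullet> t) * value_at t h" by blast
    have prod_diff: "a * b - a' * b' = l * (c * b + a * d - l * c * d)"
      if "a - a' = l * c" "b - b' = l * d" for a b a' b' l c d :: complex
    proof -
      have "a' = a - l * c" using that(1)[symmetric] by simp
      moreover have "b' = b - l * d" using that(2)[symmetric] by simp
      ultimately show ?thesis by (simp add: left_diff_distrib right_diff_distrib distrib_left mult_ac)
    qed
    have "value_at t (p * q) - value_at (t - (x \<bullet> t) *\<^sub>R u) (p * q) =
        complex_of_real (x \<bullet> t) * value_at t (g * q + p * h - linear_poly x * g * h)" for t
      by (simp only: value_at_mult value_at_add value_at_diff value_at_linear_poly) (rule prod_diff[OF gh])
    then show ?case by blast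
  qed
  then show thesis using that by blast
qed

section \<open>Powers in a pencil of commuting operators\<close>

text \<open>Applying a functional that vanishes on \<open>A\<close> turns questions about membership in \<open>A\<close> into questions
  about univariate polynomials with complex coefficients.\<close>

lemma separating_functional:
  fixes A :: "'n cpoly set"
  assumes A: "cpoly.subspace A" and x: "x \<notin> A"
  obtains l :: "'n cpoly \<Rightarrow> complex"
  where "module_hom poly_scale (*) l" "\<And>a. a \<in> A \<Longrightarrow> l a = 0" "l x = 1"
proof -
  interpret pair: vector_space_pair "poly_scale :: _ \<Rightarrow> 'n cpoly \<Rightarrow> _" "(*) :: complex \<Rightarrow> _"
    by unfold_locales (simp_all add: distrib_left distrib_right)
  obtain B where B: "B \<subseteq> A" "cpoly.independent B" "A \<subseteq> cpoly.span B"
    using cpoly.maximal_independent_subset by blast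
  have "cpoly.span B = A"
    using B A by (metis cpoly.span_subspace)
  then have "cpoly.independent (insert x B)"
    using x B(2) by (simp add: cpoly.independent_insertI)
  then obtain l where l: "Vector_Spaces.linear poly_scale (*) l" "\<forall>y\<in>insert x B. l y = (if y = x then 1 else 0)"
    using pair.linear_independent_extend[of "insert x B" "\<lambda>y. if y = x then 1 else 0"] by blast
  have zero: "l b = 0" if "b \<in> B" for b
    using that l(2) B(1) x by auto
  interpret l: module_hom poly_scale "(*)" l
    using l(1) by (simp add: module_hom_iff_linear)
  have "cpoly.subspace {p. l p = 0}"
    by (rule cpoly.subspaceI) (simp_all add: l.add l.scale)
  then have "cpoly.span B \<subseteq> {p. l p = 0}"
    using zero by (intro cpoly.span_minimal) auto
  then have "l a = 0" if "a \<in> A" for a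
    using that \<open>cpoly.span B = A\<close> by blast
  then show thesis
    using that[of l] l by (simp add: module_hom_iff_linear)
qed

lemma funpow_commute: "(\<And>p. S (T p) = T (S p)) \<Longrightarrow> S ((T ^^ k) p) = (T ^^ k) (S p)"
  by (induction k) simp_all

lemma funpow_mem: "(\<And>p. p \<in> A \<Longrightarrow> T p \<in> A) \<Longrightarrow> p \<in> A \<Longrightarrow> (T ^^ k) p \<in> A"
  by (induction k) simp_all

lemma module_hom_pencil:
  fixes S T :: "'n cpoly \<Rightarrow> 'n cpoly"
  assumes "module_hom poly_scale poly_scale S" "module_hom poly_scale poly_scale T"
  shows "module_hom poly_scale poly_scale (\<lambda>p. S p + poly_scale w (T p))"
proof -
  interpret S: module_hom poly_scale poly_scale S by fact
  interpret T: module_hom poly_scale poly_scale T by fact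
  show ?thesis
    by unfold_locales
      (simp_all only: S.add T.add S.scale T.scale cpoly.scale_right_distrib cpoly.scale_left_commute[of w] add_ac)
qed

lemma pencil_binomial:
  fixes S T :: "'n cpoly \<Rightarrow> 'n cpoly"
  assumes S: "module_hom poly_scale poly_scale S" and T: "module_hom poly_scale poly_scale T"
    and commute: "\<And>p. S (T p) = T (S p)"
  shows "((\<lambda>p. S p + poly_scale w (T p)) ^^ M) f =
    (\<Sum>j\<le>M. poly_scale (of_nat (M choose j) * w ^ j) ((S ^^ (M - j)) ((T ^^ j) f)))"
proof (induction M)
  case 0
  then show ?case by simp
next
  case (Suc M)
  interpret S: module_hom poly_scale poly_scale S by fact
  interpret T: module_hom poly_scale poly_scale T by fact
  let ?g = "\<lambda>j. poly_scale (w ^ j) ((S ^^ (Suc M - j)) ((T ^^ j) f))"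
  have "((\<lambda>p. S p + poly_scale w (T p)) ^^ Suc M) f =
      (\<Sum>j\<le>M. poly_scale (of_nat (M choose j) * w ^ j) (S ((S ^^ (M - j)) ((T ^^ j) f)))) +
      (\<Sum>j\<le>M. poly_scale w (poly_scale (of_nat (M choose j) * w ^ j) (T ((S ^^ (M - j)) ((T ^^ j) f)))))"
    using Suc.IH by (simp add: S.sum S.scale T.sum T.scale cpoly.scale_sum_right)
  also have "(\<Sum>j\<le>M. poly_scale (of_nat (M choose j) * w ^ j) (S ((S ^^ (M - j)) ((T ^^ j) f)))) =
      (\<Sum>j\<le>M. poly_scale (of_nat (M choose j)) (?g j))"
    by (rule sum.cong) (simp_all add: Suc_diff_le)
  also have "(\<Sum>j\<le>M. poly_scale w (poly_scale (of_nat (M choose j) * w ^ j) (T ((S ^^ (M - j)) ((T ^^ j) f))))) =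
      (\<Sum>j\<le>M. poly_scale (of_nat (M choose j)) (?g (Suc j)))"
    by (rule sum.cong) (simp_all add: funpow_commute[of T S, OF commute[symmetric]] mult_ac)
  also have "(\<Sum>j\<le>M. poly_scale (of_nat (M choose j)) (?g j)) =
      ?g 0 + (\<Sum>j\<le>M. poly_scale (of_nat (M choose Suc j)) (?g (Suc j)))"
  proof -
    have "(\<Sum>j\<le>M. poly_scale (of_nat (M choose j)) (?g j)) =
        (\<Sum>j\<le>Suc M. poly_scale (of_nat (M choose j)) (?g j))"
      by (simp add: binomial_eq_0)
    then show ?thesis
      by (simp only: sum.atMost_Suc_shift) simp
  qed
  also have "?g 0 + (\<Sum>j\<le>M. poly_scale (of_nat (M choose Suc j)) (?g (Suc j))) +
      (\<Sum>j\<le>M. poly_scale (of_nat (M choose j)) (?g (Suc j))) =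
      ?g 0 + (\<Sum>j\<le>M. poly_scale (of_nat (Suc M choose Suc j)) (?g (Suc j)))"
    by (simp only: binomial_Suc_Suc of_nat_add cpoly.scale_left_distrib sum.distrib add_ac)
  also have "\<dots> = (\<Sum>j\<le>Suc M. poly_scale (of_nat (Suc M choose j)) (?g j))"
    by (simp only: sum.atMost_Suc_shift) simp
  finally show ?case by simp
qed

text \<open>If \<open>S ^ M f\<close> were outside \<open>A\<close>, a separating functional \<open>l\<close> would give a nonzero polynomial
  \<open>F(z) = l((S + z T)^M f)\<close>. The membership of \<open>T ^ n f\<close> kills its coefficients from \<open>n\<close> on, and
  expanding at \<open>c\<close>, the membership of \<open>(S + c T)^k f\<close> makes \<open>c\<close> a zero of order at least
  \<open>M + 1 - k\<close>. The zeros are too many for the degree. This is the uniqueness part of Hermite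
  interpolation.\<close>

theorem pencil_power_mem:
  fixes S T :: "'n cpoly \<Rightarrow> 'n cpoly" and k :: "complex \<Rightarrow> nat"
  assumes S: "module_hom poly_scale poly_scale S" and T: "module_hom poly_scale poly_scale T"
    and commute: "\<And>p. S (T p) = T (S p)"
    and A: "cpoly.subspace A" "\<And>p. p \<in> A \<Longrightarrow> S p \<in> A" "\<And>p. p \<in> A \<Longrightarrow> T p \<in> A"
    and T_power: "(T ^^ n) f \<in> A"
    and pencil_power: "\<And>c. c \<in> C \<Longrightarrow> ((\<lambda>p. S p + poly_scale c (T p)) ^^ k c) f \<in> A"
    and C: "finite C" "n \<le> (\<Sum>c\<in>C. Suc M - k c)" "n > 0"
  shows "(S ^^ M) f \<in> A"
proof (rule ccontr)
  assume "(S ^^ M) f \<notin> A"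
  then obtain l where l: "module_hom poly_scale (*) l" "\<And>a. a \<in> A \<Longrightarrow> l a = 0" "l ((S ^^ M) f) = 1"
    using separating_functional[OF A(1)] by blast
  interpret l: module_hom poly_scale "(*)" l by (rule l(1))
  define F where "F = (\<Sum>j\<le>M. monom (of_nat (M choose j) * l ((S ^^ (M - j)) ((T ^^ j) f))) j)"
  have poly_F: "poly F z = l (((\<lambda>p. S p + poly_scale z (T p)) ^^ M) f)" for z
    by (simp only: pencil_binomial[OF S T commute] F_def poly_sum poly_monom l.sum l.scale mult.assoc mult.left_commute)
       (simp add: mult_ac)
  have "poly F 0 = 1"
    by (simp add: poly_F l(3))
  then have "F \<noteq> 0" by auto
  have "coeff F i = 0" if "n \<le> i" for i
  proof -
    have "(T ^^ i) f = (T ^^ (i - n)) ((T ^^ n) f)"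
      using that by (simp flip: funpow_add[unfolded o_def, THEN fun_cong])
    then have "(S ^^ (M - i)) ((T ^^ i) f) \<in> A"
      using T_power A by (simp add: funpow_mem)
    then show ?thesis
      by (simp add: F_def coeff_sum coeff_monom l(2))
  qed
  then have "degree F < n"
    using \<open>F \<noteq> 0\<close> by (metis leading_coeff_0_iff not_le)
  \<comment> \<open>The binomial expansion of the pencil around \<open>c\<close> is the Taylor expansion of
    \<open>F\<close> at \<open>c\<close>.\<close>
  have dvd: "[:- c, 1:] ^ (Suc M - k c) dvd F" if c: "c \<in> C" for c
  proof -
    define R where "R = (\<lambda>p. S p + poly_scale c (T p))"
    let ?G = "\<Sum>j\<le>M. smult (of_nat (M choose j) * l ((R ^^ (M - j)) ((T ^^ j) f))) ([:- c, 1:] ^ j)"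
    have R: "module_hom poly_scale poly_scale R"
      unfolding R_def by (rule module_hom_pencil[OF S T])
    interpret T: module_hom poly_scale poly_scale T by (rule T)
    have R_commute: "R (T p) = T (R p)" for p
      by (simp add: R_def commute T.add T.scale)
    have "poly F z = poly ?G z" for z
    proof -
      have "(\<lambda>p. S p + poly_scale z (T p)) = (\<lambda>p. R p + poly_scale (z - c) (T p))"
        by (simp add: R_def add.assoc flip: cpoly.scale_left_distrib)
      then have "poly F z = l (\<Sum>j\<le>M. poly_scale (of_nat (M choose j) * (z - c) ^ j) ((R ^^ (M - j)) ((T ^^ j) f)))"
        by (simp only: poly_F pencil_binomial[OF R T R_commute, of M "z - c" f])
      also have "\<dots> = poly ?G z"
        by (simp add: l.sum l.scale poly_sum mult_ac)
      finally show ?thesis .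
    qed
    then have "F = ?G"
      using poly_eq_poly_eq_iff by blast
    moreover have "[:- c, 1:] ^ (Suc M - k c) dvd ?G"
    proof (rule dvd_sum)
      fix j assume "j \<in> {..M}"
      show "[:- c, 1:] ^ (Suc M - k c) dvd
          smult (of_nat (M choose j) * l ((R ^^ (M - j)) ((T ^^ j) f))) ([:- c, 1:] ^ j)"
      proof (cases "k c \<le> M - j")
        case True
        have "(R ^^ (M - j)) ((T ^^ j) f) = (T ^^ j) ((R ^^ (M - j - k c)) ((R ^^ k c) f))"
        proof -
          have "(R ^^ (M - j)) (T p) = T ((R ^^ (M - j)) p)" for p
            by (rule funpow_commute[symmetric]) (simp add: R_commute)
          then have "(R ^^ (M - j)) ((T ^^ j) f) = (T ^^ j) ((R ^^ (M - j)) f)"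
            by (rule funpow_commute)
          moreover have "(R ^^ (M - j)) f = (R ^^ (M - j - k c)) ((R ^^ k c) f)"
          proof -
            have "M - j = (M - j - k c) + k c" using True by simp
            then show ?thesis by (metis comp_apply funpow_add)
          qed
          ultimately show ?thesis by simp
        qed
        moreover have "(T ^^ j) ((R ^^ (M - j - k c)) ((R ^^ k c) f)) \<in> A"
        proof -
          have "R p \<in> A" if "p \<in> A" for p
            unfolding R_def using A that by (intro cpoly.subspace_add cpoly.subspace_scale) auto
          moreover have "(R ^^ k c) f \<in> A"
            unfolding R_def by (rule pencil_power[OF c])
          ultimately have "(R ^^ (M - j - k c)) ((R ^^ k c) f) \<in> A"
            by (rule funpow_mem)
          with A(3) show ?thesis by (rule funpow_mem)
        qed
        ultimately show ?thesis by (simp add: l(2))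
      next
        case False
        then show ?thesis by (intro dvd_smult le_imp_power_dvd) simp
      qed
    qed
    ultimately show ?thesis by simp
  qed
  have "n \<le> (\<Sum>c\<in>C. Suc M - k c)" by (rule C)
  also have "\<dots> \<le> (\<Sum>c\<in>C. order c F)"
    by (rule sum_mono) (use dvd \<open>F \<noteq> 0\<close> in \<open>simp add: order_divides\<close>)
  also have "\<dots> \<le> (\<Sum>c\<in>C \<inter> {z. poly F z = 0}. order c F)"
    by (rule eq_refl, rule sum.mono_neutral_right) (use C \<open>F \<noteq> 0\<close> in \<open>auto simp: order_root\<close>)
  also have "\<dots> \<le> (\<Sum>c | poly F c = 0. order c F)"
    by (rule sum_mono2) (use poly_roots_finite[OF \<open>F \<noteq> 0\<close>] in auto)
  also have "\<dots> \<le> degree F"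
    by (rule sum_order_le_degree[OF \<open>F \<noteq> 0\<close>])
  finally show False using \<open>degree F < n\<close> by simp
qed

section \<open>From facet normals to all directions\<close>

definition off_count :: "('e \<Rightarrow> real ^ 'n) \<Rightarrow> 'e set \<Rightarrow> real ^ 'n \<Rightarrow> nat" where
  "off_count v X \<eta> = card {e \<in> X. \<eta> \<bullet> v e \<noteq> 0}"

text \<open>The exponent \<open>\<epsilon>\<close> extended from facets to arbitrary directions.\<close>

definition perp_eps :: "('e \<Rightarrow> real ^ 'n) \<Rightarrow> 'e set set \<Rightarrow> real ^ 'n \<Rightarrow> nat" where
  "perp_eps v J \<eta> = (if \<exists>I\<in>J. \<forall>e\<in>I. \<eta> \<bullet> v e = 0 then 1 else 0)"

lemma extend_indep_spanning:
  assumes I: "I \<in> indep_sets v E" and W: "I \<subseteq> W" "W \<subseteq> E"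
  obtains B where "I \<subseteq> B" "B \<subseteq> W" "B \<in> indep_sets v E" "span (v ` B) = span (v ` W)"
proof -
  have "v ` I \<subseteq> v ` W" "independent (v ` I)" "inj_on v I"
    using I W by (auto simp: indep_sets_def)
  then obtain B' where B': "v ` I \<subseteq> B'" "B' \<subseteq> v ` W" "independent B'" "v ` W \<subseteq> span B'"
    using maximal_independent_subset_extend by blast
  then have "B' - v ` I \<subseteq> v ` W" by blast
  then obtain C where C: "C \<subseteq> W" "inj_on v C" "B' - v ` I = v ` C"
    by (meson subset_image_inj)
  have image: "v ` (I \<union> C) = B'" using C(3) B'(1) by (simp add: image_Un flip: C(3)) blast
  have "inj_on v (I \<union> C)"
    unfolding inj_on_Un using \<open>inj_on v I\<close> C by blast
  moreover have "span (v ` (I \<union> C)) = span (v ` W)"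
    unfolding image using B' by (metis span_mono span_minimal subspace_span subset_antisym)
  ultimately show thesis
    using that[of "I \<union> C"] W C(1) B'(3) image by (auto simp: indep_sets_def)
qed

lemma ex_indep_spanning:
  assumes "Y \<subseteq> E"
  obtains B where "B \<subseteq> Y" "B \<in> indep_sets v E" "span (v ` B) = span (v ` Y)"
proof -
  have "{} \<in> indep_sets v E" by (simp add: indep_sets_def independent_empty)
  then show thesis
    by (rule extend_indep_spanning[OF _ empty_subsetI assms]) (rule that)
qed

text \<open>A facet lies in the hyperplane orthogonal to its normal, and both have the same dimension.\<close>

lemma facet_eq_hyperplane:
  fixes v :: "'e \<Rightarrow> real ^ 'n"
  assumes "facet_normals v E \<eta>" "F \<in> facets v E"
  shows "F = {x. \<eta> F \<bullet> x = 0}"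
proof -
  have "\<eta> F \<noteq> 0" "F \<subseteq> {x. \<eta> F \<bullet> x = 0}" "dim F = CARD('n) - 1" "subspace F"
    using assms by (auto simp: facet_normals_def facets_def)
  then show ?thesis
    by (intro subspace_dim_equal) (auto simp: subspace_hyperplane dim_hyperplane)
qed

locale semi_external_arrangement =
  fixes v :: "'e \<Rightarrow> real ^ 'n" and E :: "'e set" and J :: "'e set set"
    and \<eta> :: "(real ^ 'n) set \<Rightarrow> real ^ 'n"
  assumes finite_E: "finite E"
    and spanning: "span (v ` E) = UNIV"
    and normals: "facet_normals v E \<eta>"
    and semi_external: "semi_external v E J"
    and bases_in_J: "bases v E \<subseteq> J"
    and facet_condition: "\<And>I. I \<in> indep_sets v E - bases v E \<Longrightarrow> facet_spanning v E I \<subseteq> J \<Longrightarrow> I \<in> J"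
begin

lemma J_upward:
  assumes "I \<in> J" "I' \<in> indep_sets v E" "v ` I \<subseteq> span (v ` I')"
  shows "I' \<in> J"
proof -
  have "span (v ` I) \<subseteq> span (v ` I')" using assms(3) by (simp add: span_minimal)
  then show ?thesis using assms semi_external by (auto simp: semi_external_def)
qed

lemma card_outside_eq_off_count: "F \<in> facets v E \<Longrightarrow> card (outside v E F) = off_count v E (\<eta> F)"
  using facet_eq_hyperplane[OF normals, of F] unfolding outside_def off_count_def
  by (metis (mono_tags, lifting) mem_Collect_eq)

lemma ex_facet_above:
  assumes "Y \<subseteq> E" "span (v ` Y) \<noteq> UNIV"
  obtains F where "F \<in> facets v E" "v ` Y \<subseteq> F"
proof -
  let ?P = "\<lambda>Z. Y \<subseteq> Z \<and> Z \<subseteq> E \<and> span (v ` Z) \<noteq> UNIV"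
  have fin: "finite {Z. ?P Z}"
    by (rule finite_subset[of _ "Pow E"]) (use finite_E in auto)
  have "Y \<in> {Z. ?P Z}" using assms by simp
  then have "{Z. ?P Z} \<noteq> {}" by (metis empty_iff)
  from finite_has_maximal[OF fin this]
  obtain Z where Z: "Z \<in> {Z. ?P Z}" and max': "\<forall>Z'\<in>{Z. ?P Z}. Z \<subseteq> Z' \<longrightarrow> Z = Z'"
    by (rule bexE)
  have max: "Z' = Z" if "Y \<subseteq> Z'" "Z' \<subseteq> E" "span (v ` Z') \<noteq> UNIV" "Z \<subseteq> Z'" for Z'
    using max'[rule_format, of Z'] that by auto
  have Z: "Y \<subseteq> Z" "Z \<subseteq> E" "span (v ` Z) \<noteq> UNIV" using Z by simp_all
  have "Z \<noteq> E" using Z(3) spanning by metis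
  then obtain e where e: "e \<in> E" "e \<notin> Z" using Z(2) by blast
  have "span (v ` insert e Z) = UNIV"
  proof (rule ccontr)
    assume "span (v ` insert e Z) \<noteq> UNIV"
    then have "insert e Z = Z" using Z e by (intro max) auto
    then show False using e by blast
  qed
  then have "dim (insert (v e) (v ` Z)) = CARD('n)"
    by (simp flip: dim_eq_full)
  then have "CARD('n) \<le> dim (v ` Z) + 1"
    by (simp add: dim_insert split: if_splits)
  moreover have "dim (v ` Z) \<noteq> CARD('n)"
    using Z dim_eq_full[of "v ` Z"] by simp
  moreover have "dim (v ` Z) \<le> CARD('n)"
    using dim_subset_UNIV[of "v ` Z"] by simp
  ultimately have "dim (span (v ` Z)) = CARD('n) - 1" by simp
  then have "span (v ` Z) \<in> facets v E" using Z by (auto simp: facets_def)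
  moreover have "v ` Y \<subseteq> span (v ` Z)" using Z by (meson image_mono span_superset subset_trans)
  ultimately show thesis by (rule that)
qed

text \<open>This is the one place where the additional condition on \<open>J\<close> enters: if \<open>\<zeta>\<close> is orthogonal to no
  member of \<open>J\<close>, a basis of the span of the vectors orthogonal to \<open>\<zeta>\<close> is missing from \<open>J\<close>, so by
  the condition some facet above it is spanned by a set missing from \<open>J\<close>.\<close>

lemma ex_facet_above_direction:
  assumes "\<zeta> \<noteq> 0"
  obtains F where "F \<in> facets v E" "\<And>e. e \<in> E \<Longrightarrow> \<zeta> \<bullet> v e = 0 \<Longrightarrow> v e \<in> F"
    "facet_eps v J F \<le> perp_eps v J \<zeta>"
proof -
  define Y where "Y = {e \<in> E. \<zeta> \<bullet> v e = 0}"
  have "v ` Y \<subseteq> {x. \<zeta> \<bullet> x = 0}" by (auto simp: Y_def)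
  then have "span (v ` Y) \<subseteq> {x. \<zeta> \<bullet> x = 0}" by (simp add: span_minimal subspace_hyperplane)
  moreover have "\<zeta> \<notin> {x. \<zeta> \<bullet> x = 0}" using assms by simp
  ultimately have not_UNIV: "span (v ` Y) \<noteq> UNIV" by blast
  have "Y \<subseteq> E" by (auto simp: Y_def)
  show thesis
  proof (cases "perp_eps v J \<zeta> = 0")
    case False
    obtain F where F: "F \<in> facets v E" "v ` Y \<subseteq> F"
      using ex_facet_above[OF \<open>Y \<subseteq> E\<close> not_UNIV] by blast
    have "facet_eps v J F \<le> perp_eps v J \<zeta>"
      using False by (simp add: facet_eps_def perp_eps_def split: if_splits)
    then show thesis using that F by (auto simp: Y_def)
  next
    case True
    obtain B where B: "B \<subseteq> Y" "B \<in> indep_sets v E" "span (v ` B) = span (v ` Y)"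
      using ex_indep_spanning[OF \<open>Y \<subseteq> E\<close>] by metis
    have "\<zeta> \<bullet> v e = 0" if "e \<in> B" for e
      using that B(1) by (auto simp: Y_def)
    then have "B \<notin> J" using True by (auto simp: perp_eps_def split: if_splits)
    moreover have "B \<notin> bases v E" using B(3) not_UNIV by (simp add: bases_def)
    ultimately obtain I' where I': "I' \<in> facet_spanning v E B" "I' \<notin> J"
      using facet_condition B(2) by blast
    let ?F = "span (v ` I')"
    have F: "?F \<in> facets v E" "v ` B \<subseteq> ?F" "I' \<in> indep_sets v E"
      using I'(1) by (auto simp: facet_spanning_def)
    have "span (v ` Y) \<subseteq> ?F" using F(2) B(3) span_minimal[OF _ subspace_span] by metis
    then have "v ` Y \<subseteq> ?F" using span_superset by blast
    moreover have "facet_eps v J ?F = 0"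
      using J_upward[OF _ F(3)] I'(2) span_superset by (fastforce simp: facet_eps_def)
    ultimately show thesis using that[of ?F] F(1) by (auto simp: Y_def)
  qed
qed

text \<open>The powers for facet normals force those for all directions, by induction on the number of elements
  that are not orthogonal to \<open>\<zeta>\<close>. The operators are abstract in order to cover multiplication by
  linear forms, where \<open>A\<close> is an ideal and \<open>f = 1\<close>, as well as directional derivatives, where
  \<open>A = {0}\<close>.\<close>

theorem direction_power_mem:
  fixes T :: "real ^ 'n \<Rightarrow> 'n cpoly \<Rightarrow> 'n cpoly"
  assumes hom: "\<And>\<zeta>. module_hom poly_scale poly_scale (T \<zeta>)"
    and T_add: "\<And>\<zeta> \<xi> p. T (\<zeta> + \<xi>) p = T \<zeta> p + T \<xi> p"
    and T_scaleR: "\<And>r \<zeta> p. T (r *\<^sub>R \<zeta>) p = poly_scale (complex_of_real r) (T \<zeta> p)"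
    and commute: "\<And>\<zeta> \<xi> p. T \<zeta> (T \<xi> p) = T \<xi> (T \<zeta> p)"
    and A: "cpoly.subspace A" "\<And>\<zeta> p. p \<in> A \<Longrightarrow> T \<zeta> p \<in> A"
    and facets: "\<And>F. F \<in> facets v E \<Longrightarrow> (T (\<eta> F) ^^ (card (outside v E F) + facet_eps v J F)) f \<in> A"
  shows "(T \<zeta> ^^ (off_count v E \<zeta> + perp_eps v J \<zeta>)) f \<in> A"
proof (induction "off_count v E \<zeta>" arbitrary: \<zeta> rule: less_induct)
  case less
  have A_mono: "(T \<xi> ^^ k) f \<in> A" if "(T \<xi> ^^ m) f \<in> A" "m \<le> k" for \<xi> m k
  proof -
    have "(T \<xi> ^^ k) f = (T \<xi> ^^ (k - m)) ((T \<xi> ^^ m) f)"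
      using that(2) by (simp flip: funpow_add[unfolded o_def, THEN fun_cong])
    then show ?thesis using funpow_mem[of A "T \<xi>"] A(2) that(1) by simp
  qed
  show ?case
  proof (cases "\<zeta> = 0")
    case True
    obtain B where "B \<in> indep_sets v E" "span (v ` B) = UNIV"
      using ex_indep_spanning[OF order_refl, of E v] spanning by metis
    then have "bases v E \<noteq> {}" by (auto simp: bases_def)
    then have "perp_eps v J \<zeta> = 1"
      using bases_in_J True by (auto simp: perp_eps_def)
    moreover have "T 0 f = 0"
      using T_scaleR[of 0 0 f] by simp
    ultimately show ?thesis
      using True A(1) by (simp add: off_count_def cpoly.subspace_0)
  next
    case False
    obtain F where F: "F \<in> facets v E" and above: "\<And>e. e \<in> E \<Longrightarrow> \<zeta> \<bullet> v e = 0 \<Longrightarrow> v e \<in> F"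
      and eps: "facet_eps v J F \<le> perp_eps v J \<zeta>"
      using ex_facet_above_direction[OF False] by blast
    \<comment> \<open>The pencil runs in the direction of the facet normal; \<open>r e\<close> is the parameter at
      which it becomes orthogonal to \<open>e\<close>.\<close>
    define \<xi> where "\<xi> = \<eta> F"
    define N where "N = {e \<in> E. \<xi> \<bullet> v e \<noteq> 0}"
    define r where "r e = - ((\<zeta> \<bullet> v e) / (\<xi> \<bullet> v e))" for e
    define \<epsilon> where "\<epsilon> = perp_eps v J \<zeta>"
    have "finite N" using finite_E by (simp add: N_def)
    have above': "\<xi> \<bullet> v e = 0" if "e \<in> E" "\<zeta> \<bullet> v e = 0" for e
      using above[OF that] facet_eq_hyperplane[OF normals F] by (auto simp: \<xi>_def)
    have "N \<noteq> {}"
    proof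
      assume "N = {}"
      then have "v ` E \<subseteq> {x. \<xi> \<bullet> x = 0}" by (auto simp: N_def)
      then have "UNIV \<subseteq> {x. \<xi> \<bullet> x = 0}" using spanning span_minimal[OF _ subspace_hyperplane] by metis
      then have "\<xi> \<bullet> \<xi> = 0" by blast
      then show False using normals F by (simp add: \<xi>_def facet_normals_def)
    qed
    define G where "G s = {e \<in> N. r e = s}" for s
    have count: "off_count v E (\<zeta> + s *\<^sub>R \<xi>) + card (G s) = off_count v E \<zeta>" for s
    proof -
      have "{e \<in> E. \<zeta> \<bullet> v e \<noteq> 0} = {e \<in> E. (\<zeta> + s *\<^sub>R \<xi>) \<bullet> v e \<noteq> 0} \<union> G s"
      proof (intro equalityI subsetI)
        fix e assume e: "e \<in> {e \<in> E. \<zeta> \<bullet> v e \<noteq> 0}"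
        show "e \<in> {e \<in> E. (\<zeta> + s *\<^sub>R \<xi>) \<bullet> v e \<noteq> 0} \<union> G s"
        proof (cases "(\<zeta> + s *\<^sub>R \<xi>) \<bullet> v e = 0")
          case True
          then have *: "\<zeta> \<bullet> v e + s * (\<xi> \<bullet> v e) = 0" by (simp add: inner_add_left)
          then have "\<xi> \<bullet> v e \<noteq> 0" using e by auto
          moreover have "- (\<zeta> \<bullet> v e) = s * (\<xi> \<bullet> v e)" using * by linarith
          ultimately have "r e = s" unfolding r_def by (metis minus_divide_left nonzero_mult_div_cancel_right)
          then show ?thesis using e \<open>\<xi> \<bullet> v e \<noteq> 0\<close> by (simp add: G_def N_def)
        qed (use e in simp)
      next
        fix e assume "e \<in> {e \<in> E. (\<zeta> + s *\<^sub>R \<xi>) \<bullet> v e \<noteq> 0} \<union> G s"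
        then show "e \<in> {e \<in> E. \<zeta> \<bullet> v e \<noteq> 0}"
          using above'[of e] by (auto simp: G_def N_def inner_add_left)
      qed
      moreover have "{e \<in> E. (\<zeta> + s *\<^sub>R \<xi>) \<bullet> v e \<noteq> 0} \<inter> G s = {}"
        by (auto simp: G_def N_def inner_add_left r_def)
      moreover have "finite (G s)" using \<open>finite N\<close> by (simp add: G_def)
      ultimately show ?thesis
        using finite_E by (simp add: off_count_def card_Un_disjoint)
    qed
    have "off_count v E \<xi> = card N" by (simp add: off_count_def N_def)
    \<comment> \<open>The zero at \<open>s\<close> contributes \<open>card (G s) + \<epsilon>\<close>. The
      cardinalities sum up to \<open>card N\<close>, and since there is at least one zero,
      \<open>\<epsilon>\<close> is gained at least once.\<close>
    let ?k = "\<lambda>c. off_count v E (\<zeta> + Re c *\<^sub>R \<xi>) + 1"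
    have "(T \<zeta> ^^ (off_count v E \<zeta> + \<epsilon>)) f \<in> A"
    proof (rule pencil_power_mem[where S = "T \<zeta>" and T = "T \<xi>" and n = "card N + \<epsilon>"
          and C = "complex_of_real ` r ` N" and k = ?k])
      show "(T \<xi> ^^ (card N + \<epsilon>)) f \<in> A"
        using A_mono[OF facets[OF F]] eps card_outside_eq_off_count[OF F] \<open>off_count v E \<xi> = card N\<close>
        by (simp add: \<xi>_def \<epsilon>_def)
    next
      fix c assume "c \<in> complex_of_real ` r ` N"
      then obtain e where e: "e \<in> N" "c = complex_of_real (r e)" by blast
      then have "e \<in> G (r e)" by (simp add: G_def)
      then have "card (G (r e)) > 0" using \<open>finite N\<close> by (auto simp: card_gt_0_iff G_def)
      then have "off_count v E (\<zeta> + r e *\<^sub>R \<xi>) < off_count v E \<zeta>"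
        using count[of "r e"] by linarith
      then have "(T (\<zeta> + r e *\<^sub>R \<xi>) ^^ (off_count v E (\<zeta> + r e *\<^sub>R \<xi>) + 1)) f \<in> A"
        by (rule A_mono[OF less]) (simp add: perp_eps_def)
      moreover have "T (\<zeta> + r e *\<^sub>R \<xi>) = (\<lambda>p. T \<zeta> p + poly_scale c (T \<xi> p))"
        by (simp add: fun_eq_iff T_add T_scaleR e(2))
      ultimately show "((\<lambda>p. T \<zeta> p + poly_scale c (T \<xi> p)) ^^ ?k c) f \<in> A"
        using e(2) by simp
    next
      have "(\<Sum>c\<in>complex_of_real ` r ` N. Suc (off_count v E \<zeta> + \<epsilon>) - ?k c) =
          (\<Sum>s\<in>r ` N. Suc (off_count v E \<zeta> + \<epsilon>) - (off_count v E (\<zeta> + s *\<^sub>R \<xi>) + 1))"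
        by (subst sum.reindex) (auto simp: inj_on_def)
      also have "\<dots> = (\<Sum>s\<in>r ` N. card (G s) + \<epsilon>)"
      proof (rule sum.cong)
        fix s
        show "Suc (off_count v E \<zeta> + \<epsilon>) - (off_count v E (\<zeta> + s *\<^sub>R \<xi>) + 1) = card (G s) + \<epsilon>"
          using count[of s] by linarith
      qed simp
      also have "\<dots> = (\<Sum>s\<in>r ` N. card (G s)) + card (r ` N) * \<epsilon>"
        by (simp add: sum.distrib)
      also have "(\<Sum>s\<in>r ` N. card (G s)) = card N"
        unfolding G_def using sum.image_gen[OF \<open>finite N\<close>, of "\<lambda>_. 1::nat" r] by simp
      finally show "card N + \<epsilon> \<le> (\<Sum>c\<in>complex_of_real ` r ` N. Suc (off_count v E \<zeta> + \<epsilon>) - ?k c)"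
        using \<open>N \<noteq> {}\<close> \<open>finite N\<close> by (simp add: Suc_le_eq card_gt_0_iff)
    next
      show "card N + \<epsilon> > 0" using \<open>N \<noteq> {}\<close> \<open>finite N\<close> by (simp add: card_gt_0_iff)
    qed (use hom commute A \<open>finite N\<close> in auto)
    then show ?thesis by (simp add: \<epsilon>_def)
  qed
qed

end

section \<open>Polarisation\<close>

text \<open>The Vandermonde argument, in the form that a polynomial with infinitely many zeros vanishes.\<close>

lemma coefficients_mem_subspace:
  fixes g :: "nat \<Rightarrow> 'n cpoly"
  assumes A: "cpoly.subspace A"
    and mem: "\<And>s::real. (\<Sum>j\<le>m. poly_scale (complex_of_real s ^ j) (g j)) \<in> A"
    and i: "i \<le> m"
  shows "g i \<in> A"
proof (rule ccontr)
  assume "g i \<notin> A"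
  then obtain l where l: "module_hom poly_scale (*) l" "\<And>a. a \<in> A \<Longrightarrow> l a = 0" "l (g i) = 1"
    using separating_functional[OF A] by blast
  interpret l: module_hom poly_scale "(*)" l by (rule l(1))
  define F where "F = (\<Sum>j\<le>m. monom (l (g j)) j)"
  have "poly F (complex_of_real s) = 0" for s
    using l(2)[OF mem[of s]] by (simp add: F_def poly_sum poly_monom l.sum l.scale mult.commute)
  then have "F = 0" by (rule poly_eq_0_if_real_zeros)
  moreover have "coeff F i = 1"
    using i l(3) by (simp add: F_def coeff_sum coeff_monom)
  ultimately show False by simp
qed

lemma module_hom_mult: "module_hom poly_scale poly_scale ((*) (a :: 'n cpoly))"
  by (intro module_hom.intro module_hom_axioms.intro cpoly.module_axioms)
    (simp_all only: distrib_left poly_scale_mult_right)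

lemma funpow_mult_left: "((*) a ^^ k) p = a ^ k * (p :: 'a::comm_semiring_1)"
  by (induction k) (simp_all add: mult.assoc)

text \<open>The coefficient of \<open>s\<close> in the expansion of the power is a nonzero multiple of the product.\<close>

lemma linear_poly_pencil_coefficient:
  fixes p :: "'n::finite cpoly"
  assumes A: "cpoly.subspace A"
    and mem: "\<And>s. linear_poly (\<zeta> + s *\<^sub>R \<xi>) ^ Suc m * p \<in> A"
  shows "linear_poly \<zeta> ^ m * (linear_poly \<xi> * p) \<in> A"
proof -
  let ?S = "(*) (linear_poly \<zeta>)" and ?T = "(*) (linear_poly \<xi>)"
  define g where "g j = poly_scale (of_nat (Suc m choose j)) ((?S ^^ (Suc m - j)) ((?T ^^ j) p))" for j
  have "g 1 \<in> A"
  proof (rule coefficients_mem_subspace[OF A])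
    fix s :: real
    have eq: "(\<lambda>q. ?S q + poly_scale (complex_of_real s) (?T q)) = (*) (linear_poly (\<zeta> + s *\<^sub>R \<xi>))"
      by (simp only: fun_eq_iff linear_poly_add linear_poly_scaleR distrib_right poly_scale_mult_left) simp
    have "linear_poly (\<zeta> + s *\<^sub>R \<xi>) ^ Suc m * p =
        ((\<lambda>q. ?S q + poly_scale (complex_of_real s) (?T q)) ^^ Suc m) p"
      by (simp only: eq funpow_mult_left)
    also have "\<dots> = (\<Sum>j\<le>Suc m. poly_scale (of_nat (Suc m choose j) * complex_of_real s ^ j)
        ((?S ^^ (Suc m - j)) ((?T ^^ j) p)))"
      by (rule pencil_binomial[of ?S ?T, OF module_hom_mult module_hom_mult mult.left_commute])
    also have "\<dots> = (\<Sum>j\<le>Suc m. poly_scale (complex_of_real s ^ j) (g j))"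
      unfolding g_def by (rule sum.cong) (simp_all only: cpoly.scale_scale mult.commute)
    finally show "(\<Sum>j\<le>Suc m. poly_scale (complex_of_real s ^ j) (g j)) \<in> A"
      using mem[of s] by simp
  qed simp
  moreover have "g 1 = poly_scale (of_nat (Suc m)) (linear_poly \<zeta> ^ m * (linear_poly \<xi> * p))"
    by (simp only: g_def funpow_mult_left power_one_right diff_Suc_1 One_nat_def binomial_Suc_n)
      (simp add: binomial_1)
  ultimately have "poly_scale (1 / of_nat (Suc m))
      (poly_scale (of_nat (Suc m)) (linear_poly \<zeta> ^ m * (linear_poly \<xi> * p))) \<in> A"
    using A cpoly.subspace_scale by metis
  then show ?thesis by (simp del: of_nat_Suc)
qed

text \<open>By Euler's formula a polynomial \<open>p\<close> of degree \<open>j + 1\<close> is a combination of products of linear forms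
  with its partial derivatives; if \<open>p\<close> is constant along \<open>S\<close>, the linear forms can be projected to
  the orthogonal complement of \<open>S\<close>. Induction on the degree \<open>j\<close> shows that \<open>p_\<zeta> ^ (k - j) p\<close> lies
  in \<open>A\<close>, where polarisation of the power trades one factor \<open>p_\<zeta>\<close> for another linear form.\<close>

theorem homogeneous_perp_subset:
  fixes A :: "'n::finite cpoly set"
  assumes A: "cpoly.subspace A" and S: "subspace S"
    and powers: "\<And>\<zeta>. (\<And>x. x \<in> S \<Longrightarrow> \<zeta> \<bullet> x = 0) \<Longrightarrow> linear_poly \<zeta> ^ k \<in> A"
  shows "homogeneous_perp k S \<subseteq> A"
proof -
  \<comment> \<open>The \<open>z i\<close> are the projections of the unit vectors; they are the rows of a
    symmetric matrix.\<close>
  have "\<exists>z. (\<forall>x\<in>S. z \<bullet> x = 0) \<and> axis i 1 - z \<in> S" for i :: 'n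
  proof -
    obtain y z where "y \<in> span S" "\<And>w. w \<in> span S \<Longrightarrow> orthogonal z w" "axis i 1 = y + z"
      using orthogonal_subspace_decomp_exists[of S "axis i 1"] by blast
    moreover have "span S = S" using S by (simp add: span_eq_iff)
    ultimately show ?thesis
      by (intro exI[of _ z]) (auto simp: orthogonal_def)
  qed
  then obtain z where z_perp: "\<And>i x. x \<in> S \<Longrightarrow> z i \<bullet> x = 0" and z_diff: "\<And>i. axis i 1 - z i \<in> S"
    by metis
  have z_sym: "z i $ j = z j $ i" for i j
  proof -
    have "z i \<bullet> axis j 1 = z i \<bullet> z j" for i j
      using z_perp[OF z_diff, of i j] by (simp add: inner_diff_right)
    then show ?thesis
      by (metis inner_axis inner_commute inner_real_def mult.right_neutral)
  qed
  have "linear_poly \<zeta> ^ (k - j) * p \<in> A"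
    if "j \<le> k" "p \<in> homogeneous_perp j S" "\<And>x. x \<in> S \<Longrightarrow> \<zeta> \<bullet> x = 0" for j p \<zeta>
    using that
  proof (induction j arbitrary: p \<zeta>)
    case 0
    have "m = 0" if "m \<in> Poly_Mapping.keys p" for m
    proof -
      have "(\<Sum>i\<in>UNIV. Poly_Mapping.lookup m i) = 0"
        using that 0 by (auto simp: homogeneous_perp_def homogeneous_def)
      then show ?thesis by (intro poly_mapping_eqI) simp
    qed
    then have "p = Poly_Mapping.single 0 (Poly_Mapping.lookup p 0)"
      by (intro poly_mapping_eqI) (auto simp: lookup_single when_def in_keys_iff)
    then have "linear_poly \<zeta> ^ (k - 0) * p = poly_scale (Poly_Mapping.lookup p 0) (linear_poly \<zeta> ^ k)"
      by (metis poly_scale_def mult.commute diff_zero)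
    moreover have "linear_poly \<zeta> ^ k \<in> A" using 0 by (intro powers) auto
    ultimately show ?case using A by (simp add: cpoly.subspace_scale)
  next
    case (Suc j)
    have p: "p \<in> homogeneous (Suc j)" "\<And>\<xi>. \<xi> \<in> S \<Longrightarrow> dir_deriv \<xi> p = 0"
      using Suc.prems by (auto simp: homogeneous_perp_def)
    have partial: "partial_deriv i p \<in> homogeneous_perp j S" for i
      using p by (auto simp: homogeneous_perp_def homogeneous_partial_deriv dir_deriv_partial_deriv)
    have z_deriv: "partial_deriv i p = (\<Sum>j\<in>UNIV. poly_scale (complex_of_real (z i $ j)) (partial_deriv j p))" for i
    proof -
      have "partial_deriv i p = dir_deriv ((axis i 1 - z i) + z i) p"
        by (simp add: dir_deriv_axis)
      also have "\<dots> = dir_deriv (z i) p"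
        unfolding dir_deriv_vec_add using p(2)[OF z_diff] by simp
      finally show ?thesis by (simp add: dir_deriv_def)
    qed
    have "poly_scale (of_nat (Suc j)) p = (\<Sum>i\<in>UNIV. linear_poly (axis i 1) * partial_deriv i p)"
      by (rule euler_homogeneous[OF p(1)])
    also have "\<dots> = (\<Sum>i\<in>UNIV. \<Sum>j\<in>UNIV.
        poly_scale (complex_of_real (z i $ j)) (linear_poly (axis i 1)) * partial_deriv j p)"
      by (subst z_deriv) (simp add: sum_distrib_left poly_scale_mult_right flip: poly_scale_mult_left)
    also have "\<dots> = (\<Sum>j\<in>UNIV. (\<Sum>i\<in>UNIV.
        poly_scale (complex_of_real (z j $ i)) (linear_poly (axis i 1))) * partial_deriv j p)"
      by (subst sum.swap) (simp only: sum_distrib_right z_sym)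
    also have "\<dots> = (\<Sum>j\<in>UNIV. linear_poly (z j) * partial_deriv j p)"
      by (simp only: linear_poly_eq_sum[symmetric])
    finally have euler: "poly_scale (of_nat (Suc j)) p = (\<Sum>j\<in>UNIV. linear_poly (z j) * partial_deriv j p)" .
    have "linear_poly \<zeta> ^ (k - Suc j) * (linear_poly (z i) * partial_deriv i p) \<in> A" for i
    proof (rule linear_poly_pencil_coefficient[OF A])
      fix s
      have "linear_poly (\<zeta> + s *\<^sub>R z i) ^ (k - j) * partial_deriv i p \<in> A"
      proof (rule Suc.IH)
        show "j \<le> k" using Suc.prems by simp
        show "(\<zeta> + s *\<^sub>R z i) \<bullet> x = 0" if "x \<in> S" for x
          using that Suc.prems(3) z_perp by (simp add: inner_add_left)
      qed (rule partial)
      moreover have "k - j = Suc (k - Suc j)" using Suc.prems(1) by simp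
      ultimately show "linear_poly (\<zeta> + s *\<^sub>R z i) ^ Suc (k - Suc j) * partial_deriv i p \<in> A"
        by simp
    qed
    then have "(\<Sum>i\<in>UNIV. linear_poly \<zeta> ^ (k - Suc j) * (linear_poly (z i) * partial_deriv i p)) \<in> A"
      using A by (simp add: cpoly.subspace_sum)
    then have "linear_poly \<zeta> ^ (k - Suc j) * poly_scale (of_nat (Suc j)) p \<in> A"
      by (simp only: euler sum_distrib_left)
    then have "poly_scale (of_nat (Suc j)) (linear_poly \<zeta> ^ (k - Suc j) * p) \<in> A"
      by (simp only: poly_scale_mult_right)
    then have "poly_scale (1 / of_nat (Suc j)) (poly_scale (of_nat (Suc j)) (linear_poly \<zeta> ^ (k - Suc j) * p)) \<in> A"
      by (rule cpoly.subspace_scale[OF A])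
    then show ?case by (simp del: of_nat_Suc)
  qed
  from this[of k _ 0] show ?thesis by auto
qed

section \<open>Equality of the two ideals\<close>

lemma subspace_ideal_of: "cpoly.subspace (ideal_of G)" for G :: "'n::finite cpoly set"
proof (rule cpoly.subspaceI)
  show "0 \<in> ideal_of G" by (rule ideal.span_zero)
  show "p + q \<in> ideal_of G" if "p \<in> ideal_of G" "q \<in> ideal_of G" for p q
    using that by (rule ideal.span_add)
  show "poly_scale c p \<in> ideal_of G" if "p \<in> ideal_of G" for c p
    unfolding poly_scale_def using that by (rule ideal.span_scale)
qed

context semi_external_arrangement
begin

lemma linear_poly_power_mem_ideal_eps:
  "linear_poly \<zeta> ^ (off_count v E \<zeta> + perp_eps v J \<zeta>) \<in> ideal_eps v E J \<eta>"
proof -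
  have "((\<lambda>q. linear_poly \<zeta> * q) ^^ (off_count v E \<zeta> + perp_eps v J \<zeta>)) 1 \<in> ideal_eps v E J \<eta>"
  proof (rule direction_power_mem[where T = "\<lambda>\<zeta> q. linear_poly \<zeta> * q"])
    show "cpoly.subspace (ideal_eps v E J \<eta>)"
      unfolding ideal_eps_def by (rule subspace_ideal_of)
    show "linear_poly \<zeta> * p \<in> ideal_eps v E J \<eta>" if "p \<in> ideal_eps v E J \<eta>" for \<zeta> p
      using that unfolding ideal_eps_def by (rule ideal.span_scale)
    show "((*) (linear_poly (\<eta> F)) ^^ (card (outside v E F) + facet_eps v J F)) 1 \<in> ideal_eps v E J \<eta>"
      if "F \<in> facets v E" for F
      unfolding ideal_eps_def funpow_mult_left using that by (intro ideal.span_base) auto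
  qed (simp_all only: module_hom_mult linear_poly_add linear_poly_scaleR distrib_right
      poly_scale_mult_left mult.left_commute)
  then show ?thesis by (simp add: funpow_mult_left)
qed

lemma ideal_of_power_mono:
  fixes a :: "'n cpoly"
  assumes "a ^ m \<in> ideal_of G" "m \<le> k"
  shows "a ^ k \<in> ideal_of G"
proof -
  have "a ^ (k - m) * a ^ m \<in> ideal_of G"
    using assms(1) by (rule ideal.span_scale)
  then show ?thesis
    using assms(2) by (simp flip: power_add)
qed

text \<open>For a missing span \<open>S\<close>, the powers of \<open>p_\<zeta>\<close> that are needed, with \<open>\<zeta>\<close> orthogonal to \<open>S\<close>, have
  as exponent the number of elements outside \<open>S\<close>. If the elements orthogonal to \<open>\<zeta>\<close> are exactly
  those in \<open>S\<close>, then no member of \<open>J\<close> is orthogonal to \<open>\<zeta>\<close> and the exponent is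
  \<open>m(\<zeta>) + \<epsilon>(\<zeta>) = m(\<zeta>)\<close>; otherwise the exponent is at least \<open>m(\<zeta>) + 1\<close>.\<close>

theorem ideal_semi_external_eq: "ideal_semi_external v E J \<eta> = ideal_eps v E J \<eta>"
proof
  have external: "ideal_external v E \<eta> \<subseteq> ideal_eps v E J \<eta>"
    unfolding ideal_external_def
  proof (rule ideal.span_minimal)
    show "{linear_poly (\<eta> F) ^ (card (outside v E F) + 1) | F. F \<in> facets v E} \<subseteq> ideal_eps v E J \<eta>"
    proof safe
      fix F assume "F \<in> facets v E"
      then have "linear_poly (\<eta> F) ^ (card (outside v E F) + facet_eps v J F) \<in> ideal_eps v E J \<eta>"
        unfolding ideal_eps_def by (intro ideal.span_base) auto
      then show "linear_poly (\<eta> F) ^ (card (outside v E F) + 1) \<in> ideal_eps v E J \<eta>"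
        unfolding ideal_eps_def by (rule ideal_of_power_mono) (simp add: facet_eps_def)
    qed
  qed (simp add: ideal_eps_def)
  have missing: "homogeneous_perp (card (outside v E S)) S \<subseteq> ideal_eps v E J \<eta>"
    if S: "S \<in> missing_spans v E J" for S
  proof (rule homogeneous_perp_subset)
    obtain I where I: "I \<in> indep_sets v E" "I \<notin> J" "S = span (v ` I)"
      using S by (auto simp: missing_spans_def)
    show "subspace S" using I by simp
    show "cpoly.subspace (ideal_eps v E J \<eta>)"
      unfolding ideal_eps_def by (rule subspace_ideal_of)
    fix \<zeta> assume perp: "\<And>x. x \<in> S \<Longrightarrow> \<zeta> \<bullet> x = 0"
    let ?N = "{e \<in> E. \<zeta> \<bullet> v e \<noteq> 0}"
    have sub: "?N \<subseteq> outside v E S"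
      using perp by (auto simp: outside_def)
    have fin: "finite (outside v E S)" using finite_E by (simp add: outside_def)
    have "off_count v E \<zeta> + perp_eps v J \<zeta> \<le> card (outside v E S)"
    proof (cases "?N = outside v E S")
      case True
      have "perp_eps v J \<zeta> = 0"
      proof (rule ccontr)
        assume "perp_eps v J \<zeta> \<noteq> 0"
        then obtain I' where I': "I' \<in> J" "\<And>e. e \<in> I' \<Longrightarrow> \<zeta> \<bullet> v e = 0"
          by (auto simp: perp_eps_def split: if_splits)
        have "I' \<subseteq> E"
          using I'(1) semi_external by (auto simp: semi_external_def indep_sets_def)
        have "v e \<in> S" if "e \<in> I'" for e
        proof -
          have "e \<notin> outside v E S" using I'(2)[OF that] True by blast
          then show ?thesis using that \<open>I' \<subseteq> E\<close> by (auto simp: outside_def)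
        qed
        then show False using J_upward[OF I'(1) I(1)] I(2,3) by blast
      qed
      then show ?thesis using True by (simp add: off_count_def)
    next
      case False
      then have "off_count v E \<zeta> < card (outside v E S)"
        unfolding off_count_def using sub fin by (intro psubset_card_mono) auto
      moreover have "perp_eps v J \<zeta> \<le> 1" by (simp add: perp_eps_def)
      ultimately show ?thesis by linarith
    qed
    then show "linear_poly \<zeta> ^ card (outside v E S) \<in> ideal_eps v E J \<eta>"
      using linear_poly_power_mem_ideal_eps[of \<zeta>] unfolding ideal_eps_def
      by (rule ideal_of_power_mono[rotated])
  qed
  have "ideal_of (\<Union>S\<in>missing_spans v E J. homogeneous_perp (card (outside v E S)) S) \<subseteq> ideal_eps v E J \<eta>"
    by (rule ideal.span_minimal) (use missing in \<open>auto simp: ideal_eps_def\<close>)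
  then show "ideal_semi_external v E J \<eta> \<subseteq> ideal_eps v E J \<eta>"
    using external unfolding ideal_semi_external_def ideal_eps_def
    by (auto elim!: set_plus_elim intro: ideal.span_add)
next
  let ?K = "ideal_of (\<Union>S\<in>missing_spans v E J. homogeneous_perp (card (outside v E S)) S)"
  have sub: "ideal.subspace (ideal_semi_external v E J \<eta>)"
  proof -
    have "A + B = {a + b | a b. a \<in> A \<and> b \<in> B}" for A B :: "'n cpoly set"
      by (auto simp: set_plus_def)
    then have "ideal_semi_external v E J \<eta> =
        ideal_of ({linear_poly (\<eta> F) ^ (card (outside v E F) + 1) | F. F \<in> facets v E} \<union>
          (\<Union>S\<in>missing_spans v E J. homogeneous_perp (card (outside v E S)) S))"
      unfolding ideal_semi_external_def ideal_external_def by (simp only: ideal.span_Un)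
    then show ?thesis by (simp only: ideal.subspace_span)
  qed
  show "ideal_eps v E J \<eta> \<subseteq> ideal_semi_external v E J \<eta>"
    unfolding ideal_eps_def
  proof (rule ideal.span_minimal[OF _ sub], safe)
    fix F assume F: "F \<in> facets v E"
    show "linear_poly (\<eta> F) ^ (card (outside v E F) + facet_eps v J F) \<in> ideal_semi_external v E J \<eta>"
    proof (cases "facet_eps v J F = 1")
      case True
      then have "linear_poly (\<eta> F) ^ (card (outside v E F) + facet_eps v J F) \<in> ideal_external v E \<eta>"
        unfolding ideal_external_def using F by (intro ideal.span_base) auto
      then have "linear_poly (\<eta> F) ^ (card (outside v E F) + facet_eps v J F) + 0 \<in> ideal_semi_external v E J \<eta>"
        unfolding ideal_semi_external_def by (rule set_plus_intro) (rule ideal.span_zero)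
      then show ?thesis by simp
    next
      case False
      then have eps: "facet_eps v J F = 0" by (simp add: facet_eps_def split: if_splits)
      obtain Y where Y: "Y \<subseteq> E" "F = span (v ` Y)" using F by (auto simp: facets_def)
      obtain B where B: "B \<in> indep_sets v E" "span (v ` B) = F"
        using ex_indep_spanning[OF Y(1)] Y(2) by metis
      then have "B \<notin> J" using eps by (auto simp: facet_eps_def split: if_splits)
      then have "F \<in> missing_spans v E J" using B by (auto simp: missing_spans_def)
      moreover have "linear_poly (\<eta> F) ^ card (outside v E F) \<in> homogeneous_perp (card (outside v E F)) F"
        using normals F by (auto simp: homogeneous_perp_def homogeneous_linear_poly_power
            dir_deriv_linear_poly_power facet_normals_def inner_commute)
      ultimately have "linear_poly (\<eta> F) ^ card (outside v E F) \<in> ?K"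
        by (intro ideal.span_base) auto
      then have "0 + linear_poly (\<eta> F) ^ card (outside v E F) \<in> ideal_semi_external v E J \<eta>"
        unfolding ideal_semi_external_def ideal_external_def
        by (intro set_plus_intro) (rule ideal.span_zero)
      then show ?thesis using eps by simp
    qed
  qed
qed

end

section \<open>Polynomials with prescribed degrees along lines\<close>

lemma line_degree_less_mono: "line_degree_less f t \<zeta> k \<Longrightarrow> k \<le> l \<Longrightarrow> line_degree_less f t \<zeta> l"
  by (auto simp: line_degree_less_def)

lemma line_degree_less_diff:
  "line_degree_less f t \<zeta> k \<Longrightarrow> line_degree_less g t \<zeta> k \<Longrightarrow> line_degree_less (f - g) t \<zeta> k"
  by (simp add: line_degree_less_def line_diff)

lemma line_degree_less_span:
  assumes "f \<in> cpoly_span G" "\<And>g. g \<in> G \<Longrightarrow> line_degree_less g t \<zeta> k"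
  shows "line_degree_less f t \<zeta> k"
  using assms(1)
  by (induction rule: cpoly.span_induct_alt)
    (simp_all add: line_degree_less_def line_add line_scale assms(2)[unfolded line_degree_less_def])

lemma line_degree_less_prod_poly:
  assumes "finite Y"
  shows "line_degree_less (prod_poly v Y) t \<zeta> (Suc (off_count v Y \<zeta>))"
proof -
  have "degree (line t \<zeta> (prod_poly v Y)) \<le> (\<Sum>e\<in>Y. degree [:complex_of_real (v e \<bullet> t), complex_of_real (v e \<bullet> \<zeta>):])"
    unfolding prod_poly_def line_prod line_linear_poly
    using degree_prod_sum_le[OF assms] by (simp only: o_def)
  also have "\<dots> \<le> (\<Sum>e\<in>Y. if \<zeta> \<bullet> v e \<noteq> 0 then 1 else 0)"
    by (rule sum_mono) (simp add: inner_commute)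
  also have "\<dots> = off_count v Y \<zeta>"
    using assms by (simp add: off_count_def flip: sum.inter_filter)
  finally show ?thesis
    by (auto simp: line_degree_less_def intro!: coeff_eq_0)
qed

text \<open>If no member of \<open>JJ\<close> is orthogonal to \<open>\<zeta>\<close>, the member missed by \<open>Y\<close> contains an element outside
  \<open>Y\<close> that is not orthogonal to \<open>\<zeta>\<close>, which saves one degree.\<close>

lemma line_degree_less_P_semi_external:
  assumes "finite X" "f \<in> P_semi_external v X JJ" "\<And>I. I \<in> JJ \<Longrightarrow> I \<subseteq> X"
  shows "line_degree_less f t \<zeta> (off_count v X \<zeta> + perp_eps v JJ \<zeta>)"
  using assms(2) unfolding P_semi_external_def
proof (rule line_degree_less_span)
  fix g assume "g \<in> {prod_poly v Y | Y. Y \<subseteq> X \<and> (\<exists>I\<in>JJ. Y \<inter> I = {})}"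
  then obtain Y I where Y: "g = prod_poly v Y" "Y \<subseteq> X" "I \<in> JJ" "Y \<inter> I = {}" by blast
  let ?N = "\<lambda>Y. {e \<in> Y. \<zeta> \<bullet> v e \<noteq> 0}"
  have "Suc (off_count v Y \<zeta>) \<le> off_count v X \<zeta> + perp_eps v JJ \<zeta>"
  proof (cases "\<forall>e\<in>I. \<zeta> \<bullet> v e = 0")
    case True
    then have "perp_eps v JJ \<zeta> = 1" using Y(3) by (auto simp: perp_eps_def)
    moreover have "off_count v Y \<zeta> \<le> off_count v X \<zeta>"
      unfolding off_count_def using Y(2) assms(1) by (intro card_mono) auto
    ultimately show ?thesis by simp
  next
    case False
    then obtain e where "e \<in> I" "\<zeta> \<bullet> v e \<noteq> 0" by blast
    then have "e \<in> ?N X" "e \<notin> ?N Y" using Y assms(3) by auto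
    moreover have "?N Y \<subseteq> ?N X" using Y(2) by auto
    ultimately have "?N Y \<subset> ?N X" by blast
    then have "off_count v Y \<zeta> < off_count v X \<zeta>"
      unfolding off_count_def using assms(1) by (intro psubset_card_mono) auto
    then show ?thesis by simp
  qed
  then show "line_degree_less g t \<zeta> (off_count v X \<zeta> + perp_eps v JJ \<zeta>)"
    unfolding Y(1) using line_degree_less_prod_poly[OF finite_subset[OF Y(2) assms(1)]]
    by (rule line_degree_less_mono[rotated])
qed

lemma line_degree_less_P_central:
  assumes "finite A" "f \<in> P_central v A" "\<zeta> \<noteq> 0"
  shows "line_degree_less f t \<zeta> (off_count v A \<zeta>)"
  using assms(2) unfolding P_central_def
proof (rule line_degree_less_span)
  fix g assume "g \<in> {prod_poly v Y | Y. Y \<subseteq> A \<and> dim (v ` (A - Y)) = CARD('b)}"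
  then obtain Y where Y: "g = prod_poly v Y" "Y \<subseteq> A" "dim (v ` (A - Y)) = CARD('b)" by blast
  have "\<exists>e\<in>A - Y. \<zeta> \<bullet> v e \<noteq> 0"
  proof (rule ccontr)
    assume "\<not> ?thesis"
    then have "v ` (A - Y) \<subseteq> {x. \<zeta> \<bullet> x = 0}" by auto
    then have "span (v ` (A - Y)) \<subseteq> {x. \<zeta> \<bullet> x = 0}"
      by (rule span_minimal) (rule subspace_hyperplane)
    moreover have "span (v ` (A - Y)) = UNIV"
      using Y(3) by (simp flip: dim_eq_full)
    ultimately have "\<zeta> \<bullet> \<zeta> = 0" by blast
    then show False using assms(3) by simp
  qed
  then have "{e \<in> Y. \<zeta> \<bullet> v e \<noteq> 0} \<subset> {e \<in> A. \<zeta> \<bullet> v e \<noteq> 0}"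
    using Y(2) by blast
  then have "off_count v Y \<zeta> < off_count v A \<zeta>"
    unfolding off_count_def using assms(1) by (intro psubset_card_mono) auto
  then have "Suc (off_count v Y \<zeta>) \<le> off_count v A \<zeta>" by (rule Suc_leI)
  then show "line_degree_less g t \<zeta> (off_count v A \<zeta>)"
    unfolding Y(1) using line_degree_less_prod_poly[OF finite_subset[OF Y(2) assms(1)]]
    by (rule line_degree_less_mono[rotated])
qed

text \<open>Along a line on which the linear form is not constant, the degree of a product with it drops by
  exactly one on division.\<close>

lemma line_degree_less_factor:
  assumes "line_degree_less (linear_poly x * h) t \<zeta> (Suc k)" "x \<bullet> \<zeta> \<noteq> 0"
  shows "line_degree_less h t \<zeta> k"
proof -
  let ?q = "line t \<zeta> h"
  have "degree ?q < k \<or> ?q = 0"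
  proof (rule ccontr)
    assume *: "\<not> ?thesis"
    have "coeff (line t \<zeta> (linear_poly x * h)) (Suc (degree ?q)) =
        complex_of_real (x \<bullet> \<zeta>) * lead_coeff ?q"
      by (simp add: line_mult line_linear_poly coeff_eq_0)
    moreover have "coeff (line t \<zeta> (linear_poly x * h)) (Suc (degree ?q)) = 0"
      using assms(1) * by (simp add: line_degree_less_def)
    ultimately show False using * assms(2) by simp
  qed
  then show ?thesis
  proof
    assume "degree ?q < k"
    then show ?thesis by (auto simp: line_degree_less_def intro!: coeff_eq_0)
  qed (simp add: line_degree_less_def)
qed

lemma line_degree_less_factor_perp:
  assumes "line_degree_less (linear_poly x * h) t \<zeta> k" "x \<bullet> \<zeta> = 0" "x \<bullet> t \<noteq> 0"
  shows "line_degree_less h t \<zeta> k"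
  using assms by (simp add: line_degree_less_def line_mult line_linear_poly)

lemma line_eqI:
  assumes "subspace U" "\<And>t. t \<in> U \<Longrightarrow> value_at t f = value_at t g" "t \<in> U" "\<zeta> \<in> U"
  shows "line t \<zeta> f = line t \<zeta> g"
proof -
  have "line t \<zeta> f - line t \<zeta> g = 0"
  proof (rule poly_eq_0_if_real_zeros)
    fix s :: real
    have "t + s *\<^sub>R \<zeta> \<in> U" using assms by (simp add: subspace_add subspace_scale)
    then show "poly (line t \<zeta> f - line t \<zeta> g) (complex_of_real s) = 0"
      using assms(2) by (simp add: poly_line)
  qed
  then show ?thesis by simp
qed

lemma perp_eps_mono:
  assumes "\<And>I. I \<in> JJ \<Longrightarrow> \<forall>e\<in>I. \<zeta> \<bullet> v e = 0 \<Longrightarrow> \<exists>I'\<in>JJ'. \<forall>e\<in>I'. \<zeta> \<bullet> v e = 0"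
  shows "perp_eps v JJ \<zeta> \<le> perp_eps v JJ' \<zeta>"
proof (cases "\<exists>I\<in>JJ. \<forall>e\<in>I. \<zeta> \<bullet> v e = 0")
  case True
  then have "\<exists>I'\<in>JJ'. \<forall>e\<in>I'. \<zeta> \<bullet> v e = 0" using assms by blast
  then show ?thesis by (simp add: perp_eps_def)
qed (auto simp: perp_eps_def)

lemma P_semi_external_mono:
  assumes "X \<subseteq> X'" "\<And>Y I. Y \<subseteq> X \<Longrightarrow> I \<in> JJ \<Longrightarrow> Y \<inter> I = {} \<Longrightarrow> \<exists>I'\<in>JJ'. Y \<inter> I' = {}"
  shows "P_semi_external v X JJ \<subseteq> P_semi_external v X' JJ'"
  unfolding P_semi_external_def
proof (rule cpoly.span_mono, safe)
  fix Y I assume "Y \<subseteq> X" "I \<in> JJ" "Y \<inter> I = {}"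
  then have "Y \<subseteq> X'" "\<exists>I'\<in>JJ'. Y \<inter> I' = {}"
    using assms(1) assms(2)[of Y I] by auto
  then show "\<exists>Y'. prod_poly v Y = prod_poly v Y' \<and> Y' \<subseteq> X' \<and> (\<exists>I'\<in>JJ'. Y' \<inter> I' = {})"
    by blast
qed

lemma subspace_P_semi_external: "cpoly.subspace (P_semi_external v X JJ)"
  unfolding P_semi_external_def by (rule cpoly.subspace_span)

lemma linear_poly_mult_P_semi_external:
  assumes "finite X" "x \<notin> X" "g \<in> P_semi_external v X {I \<in> JJ. x \<notin> I}"
  shows "linear_poly (v x) * g \<in> P_semi_external v (insert x X) JJ"
  using assms(3) unfolding P_semi_external_def[of v X]
proof (induction rule: cpoly.span_induct_alt)
  case base
  then show ?case using cpoly.subspace_0[OF subspace_P_semi_external] by simp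
next
  case (step c p q)
  then obtain Y I where Y: "p = prod_poly v Y" "Y \<subseteq> X" "I \<in> JJ" "x \<notin> I" "Y \<inter> I = {}" by blast
  have "finite Y" "x \<notin> Y" using Y(2) assms finite_subset by auto
  then have "linear_poly (v x) * p = prod_poly v (insert x Y)"
    by (simp add: Y(1) prod_poly_def)
  moreover have "prod_poly v (insert x Y) \<in> P_semi_external v (insert x X) JJ"
    unfolding P_semi_external_def
  proof (intro cpoly.span_base CollectI exI conjI)
    show "insert x Y \<subseteq> insert x X" using Y(2) by blast
    show "\<exists>I\<in>JJ. insert x Y \<inter> I = {}" using Y by (intro bexI[of _ I]) auto
  qed (rule refl)
  ultimately have "linear_poly (v x) * p \<in> P_semi_external v (insert x X) JJ" by simp
  then have "poly_scale c (linear_poly (v x) * p) + linear_poly (v x) * q \<in> P_semi_external v (insert x X) JJ"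
    using step.IH by (intro cpoly.subspace_add cpoly.subspace_scale subspace_P_semi_external)
  then show ?case by (simp only: distrib_left poly_scale_mult_right)
qed

text \<open>Induction on \<open>X\<close> by deletion and contraction of an element \<open>x\<close>. Contraction is modelled by the
  subspace \<open>U\<close>, which is cut with the hyperplane orthogonal to \<open>x\<close>. The family \<open>JJ\<close> is closed upwards
  with respect to spans, where the span of \<open>T\<close> modulo the orthogonal complement of \<open>U\<close> is expressed
  through the vectors of \<open>U\<close> orthogonal to \<open>T\<close>; this closure passes to deletions and contractions
  without any appeal to linear independence.

  On the smaller subspace \<open>f\<close> agrees with some \<open>g1\<close> in the required space by the induction hypothesis
  for the contraction, so \<open>f - g1\<close> is \<open>p_x h\<close> on \<open>U\<close>, and the point is that \<open>h\<close> satisfies the degree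
  bounds for the deletion. This is clear along directions not orthogonal to \<open>x\<close>, where division
  lowers the degree, and along directions orthogonal to \<open>x\<close> for which deletion does not change the
  bound. In the remaining case every member of \<open>JJ\<close> orthogonal to \<open>\<zeta>\<close> contains \<open>x\<close>; then \<open>\<zeta>\<close> is
  the limit of directions \<open>\<zeta> + s y\<close> along which the better bound holds.\<close>

theorem mem_P_semi_external_if_line_degree_less:
  fixes v :: "'e \<Rightarrow> real ^ 'n::finite"
  assumes "finite X" "subspace U" "\<And>T. T \<in> JJ \<Longrightarrow> T \<subseteq> X"
    and "\<And>T T'. T \<in> JJ \<Longrightarrow> T' \<subseteq> X \<Longrightarrow>
      (\<And>u. u \<in> U \<Longrightarrow> \<forall>e\<in>T'. u \<bullet> v e = 0 \<Longrightarrow> \<forall>e\<in>T. u \<bullet> v e = 0) \<Longrightarrow> T' \<in> JJ"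
    and "\<And>\<zeta> t. \<zeta> \<in> U \<Longrightarrow> t \<in> U \<Longrightarrow> line_degree_less f t \<zeta> (off_count v X \<zeta> + perp_eps v JJ \<zeta>)"
  shows "\<exists>g\<in>P_semi_external v X JJ. \<forall>t\<in>U. value_at t f = value_at t g"
  using assms
proof (induction X arbitrary: U JJ f rule: finite_induct)
  case empty
  have 0: "0 \<in> U" using empty.prems(1) by (rule subspace_0)
  show ?case
  proof (cases "{} \<in> JJ")
    case True
    then have "prod_poly v {} \<in> P_semi_external v {} JJ"
      unfolding P_semi_external_def by (intro cpoly.span_base) blast
    then have "poly_scale (value_at 0 f) (prod_poly v {}) \<in> P_semi_external v {} JJ"
      by (rule cpoly.subspace_scale[OF subspace_P_semi_external])
    then have "poly_scale (value_at 0 f) 1 \<in> P_semi_external v {} JJ"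
      by (simp only: prod_poly_def prod.empty)
    moreover have "value_at t f = value_at t (poly_scale (value_at 0 f) 1)" if "t \<in> U" for t
    proof -
      have "line_degree_less f 0 t 1"
        using empty.prems(4)[OF that 0] by (rule line_degree_less_mono) (simp add: off_count_def perp_eps_def)
      then have "line 0 t f = [:coeff (line 0 t f) 0:]"
        by (intro poly_eqI) (simp add: line_degree_less_def coeff_pCons split: nat.split)
      then obtain c where "line 0 t f = [:c:]" by blast
      then have "poly (line 0 t f) 1 = poly (line 0 t f) 0"
        by simp
      then show ?thesis
        using poly_line[of 0 t f 1] poly_line[of 0 t f 0] by (simp add: value_at_scale)
    qed
    ultimately show ?thesis by blast
  next
    case False
    then have "T \<notin> JJ" for T using empty.prems(2)[of T] by auto
    then have "JJ = {}" by blast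
    have "value_at t f = value_at t 0" if "t \<in> U" for t
    proof -
      have "line_degree_less f t 0 0"
        using empty.prems(4)[OF 0 that] \<open>JJ = {}\<close> by (simp add: off_count_def perp_eps_def)
      then have "line t 0 f = 0" by (intro poly_eqI) (simp add: line_degree_less_def)
      then show ?thesis using poly_line[of t 0 f 0] by simp
    qed
    then show ?thesis using cpoly.subspace_0[OF subspace_P_semi_external] by blast
  qed
next
  case (insert x X)
  note U = insert.prems(1) and JJ_sub = insert.prems(2) and closed = insert.prems(3) and bound = insert.prems(4)
  let ?JD = "{I \<in> JJ. x \<notin> I}"
  have up: "T' \<in> JJ" if "T \<in> JJ" "T \<subseteq> T'" "T' \<subseteq> insert x X" for T T'
    using that by (intro closed[of T T']) auto
  have JD_sub: "T \<subseteq> X" if "T \<in> ?JD" for T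
    using that JJ_sub[of T] by auto
  have JD_closed: "T' \<in> ?JD" if "T \<in> ?JD" "T' \<subseteq> X"
    "\<And>u. u \<in> U \<Longrightarrow> \<forall>e\<in>T'. u \<bullet> v e = 0 \<Longrightarrow> \<forall>e\<in>T. u \<bullet> v e = 0" for T T'
    using that closed[of T T'] insert.hyps by blast
  show ?case
  proof (cases "\<forall>u\<in>U. u \<bullet> v x = 0")
    case True
    have "\<exists>g\<in>P_semi_external v X ?JD. \<forall>t\<in>U. value_at t f = value_at t g"
    proof (rule insert.IH[OF U JD_sub JD_closed])
      fix \<zeta> t assume \<zeta>: "\<zeta> \<in> U" and t: "t \<in> U"
      have "{e \<in> insert x X. \<zeta> \<bullet> v e \<noteq> 0} = {e \<in> X. \<zeta> \<bullet> v e \<noteq> 0}"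
        using True \<zeta> by auto
      moreover have "perp_eps v JJ \<zeta> \<le> perp_eps v ?JD \<zeta>"
      proof -
        have *: "I - {x} \<in> ?JD" if "I \<in> JJ" for I
          using closed[of I "I - {x}"] True that JJ_sub[OF that] by blast
        show ?thesis
        proof (rule perp_eps_mono)
          fix I assume I: "I \<in> JJ" "\<forall>e\<in>I. \<zeta> \<bullet> v e = 0"
          show "\<exists>I'\<in>?JD. \<forall>e\<in>I'. \<zeta> \<bullet> v e = 0"
            by (rule bexI[OF _ *[OF I(1)]]) (use I(2) in simp)
        qed
      qed
      ultimately show "line_degree_less f t \<zeta> (off_count v X \<zeta> + perp_eps v ?JD \<zeta>)"
        using bound[OF \<zeta> t] by (intro line_degree_less_mono[OF bound[OF \<zeta> t]]) (simp add: off_count_def)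
    qed
    moreover have "P_semi_external v X ?JD \<subseteq> P_semi_external v (insert x X) JJ"
      by (rule P_semi_external_mono) auto
    ultimately show ?thesis by blast
  next
    case False
    then obtain u0 where u0: "u0 \<in> U" "u0 \<bullet> v x \<noteq> 0" by blast
    define u where "u = (1 / (u0 \<bullet> v x)) *\<^sub>R u0"
    have u: "u \<in> U" "v x \<bullet> u = 1"
      using u0 U by (simp_all add: u_def subspace_scale inner_commute)
    let ?U' = "U \<inter> {t. v x \<bullet> t = 0}" and ?JC = "{I. I \<subseteq> X \<and> insert x I \<in> JJ}"
    have "\<exists>g\<in>P_semi_external v X ?JC. \<forall>t\<in>?U'. value_at t f = value_at t g"
    proof (rule insert.IH)
      show "subspace ?U'" using U by (intro subspace_inter subspace_hyperplane)
      show "T \<subseteq> X" if "T \<in> ?JC" for T using that by simp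
      show "T' \<in> ?JC" if T: "T \<in> ?JC" "T' \<subseteq> X"
        "\<And>u. u \<in> ?U' \<Longrightarrow> \<forall>e\<in>T'. u \<bullet> v e = 0 \<Longrightarrow> \<forall>e\<in>T. u \<bullet> v e = 0" for T T'
      proof -
        have "insert x T' \<in> JJ"
        proof (rule closed[of "insert x T"])
          fix w assume "w \<in> U" "\<forall>e\<in>insert x T'. w \<bullet> v e = 0"
          then show "\<forall>e\<in>insert x T. w \<bullet> v e = 0"
            using T(3)[of w] by (simp add: inner_commute)
        qed (use T in auto)
        then show ?thesis using T(2) by simp
      qed
      fix \<zeta> t assume \<zeta>: "\<zeta> \<in> ?U'" and t: "t \<in> ?U'"
      have "{e \<in> insert x X. \<zeta> \<bullet> v e \<noteq> 0} = {e \<in> X. \<zeta> \<bullet> v e \<noteq> 0}"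
        using \<zeta> by (auto simp: inner_commute)
      moreover have "perp_eps v JJ \<zeta> \<le> perp_eps v ?JC \<zeta>"
      proof -
        have *: "I - {x} \<in> ?JC" if "I \<in> JJ" for I
          using up[OF that, of "insert x I"] JJ_sub[OF that] by auto
        show ?thesis
        proof (rule perp_eps_mono)
          fix I assume I: "I \<in> JJ" "\<forall>e\<in>I. \<zeta> \<bullet> v e = 0"
          show "\<exists>I'\<in>?JC. \<forall>e\<in>I'. \<zeta> \<bullet> v e = 0"
            by (rule bexI[OF _ *[OF I(1)]]) (use I(2) in simp)
        qed
      qed
      ultimately show "line_degree_less f t \<zeta> (off_count v X \<zeta> + perp_eps v ?JC \<zeta>)"
        using \<zeta> t by (intro line_degree_less_mono[OF bound]) (auto simp: off_count_def)
    qed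
    then obtain g1 where g1: "g1 \<in> P_semi_external v X ?JC" "\<And>t. t \<in> ?U' \<Longrightarrow> value_at t f = value_at t g1" by blast
    have "P_semi_external v X ?JC \<subseteq> P_semi_external v (insert x X) JJ"
    proof (rule P_semi_external_mono)
      show "\<exists>I'\<in>JJ. Y \<inter> I' = {}" if "Y \<subseteq> X" "I \<in> ?JC" "Y \<inter> I = {}" for Y I
        by (rule bexI[of _ "insert x I"]) (use that insert.hyps in auto)
    qed auto
    then have g1_mem: "g1 \<in> P_semi_external v (insert x X) JJ" using g1(1) by blast
    obtain h where h: "\<And>t. value_at t (f - g1) - value_at (t - (v x \<bullet> t) *\<^sub>R u) (f - g1) = complex_of_real (v x \<bullet> t) * value_at t h"
      using divide_by_linear by blast
    have diff: "value_at t (f - g1) = value_at t (linear_poly (v x) * h)" if "t \<in> U" for t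
    proof -
      have "t - (v x \<bullet> t) *\<^sub>R u \<in> ?U'"
        using that u U by (simp add: subspace_diff subspace_scale inner_diff_right)
      then show ?thesis
        using h[of t] g1(2) by (simp add: value_at_diff value_at_mult value_at_linear_poly)
    qed
    have lh: "line_degree_less (linear_poly (v x) * h) t \<zeta> (off_count v (insert x X) \<zeta> + perp_eps v JJ \<zeta>)"
      if "\<zeta> \<in> U" "t \<in> U" for \<zeta> t
    proof -
      have "line_degree_less (f - g1) t \<zeta> (off_count v (insert x X) \<zeta> + perp_eps v JJ \<zeta>)"
        using bound[OF that] line_degree_less_P_semi_external[OF _ g1_mem JJ_sub] insert.hyps
        by (intro line_degree_less_diff) auto
      then show ?thesis
        using line_eqI[OF U diff that(2,1)] by (simp add: line_degree_less_def)
    qed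
    have "\<exists>g\<in>P_semi_external v X ?JD. \<forall>t\<in>U. value_at t h = value_at t g"
    proof (rule insert.IH[OF U JD_sub JD_closed])
      fix \<zeta> t assume \<zeta>: "\<zeta> \<in> U" and t: "t \<in> U"
      show "line_degree_less h t \<zeta> (off_count v X \<zeta> + perp_eps v ?JD \<zeta>)"
      proof (cases "\<zeta> \<bullet> v x = 0")
        case False
        have "{e \<in> insert x X. \<zeta> \<bullet> v e \<noteq> 0} = insert x {e \<in> X. \<zeta> \<bullet> v e \<noteq> 0}"
          using False by auto
        then have count: "off_count v (insert x X) \<zeta> = Suc (off_count v X \<zeta>)"
          using insert.hyps by (simp add: off_count_def)
        have "perp_eps v JJ \<zeta> \<le> perp_eps v ?JD \<zeta>"
          by (rule perp_eps_mono) (use False in blast)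
        then have "off_count v (insert x X) \<zeta> + perp_eps v JJ \<zeta> \<le>
            Suc (off_count v X \<zeta> + perp_eps v ?JD \<zeta>)"
          unfolding count by simp
        then have "line_degree_less (linear_poly (v x) * h) t \<zeta>
            (Suc (off_count v X \<zeta> + perp_eps v ?JD \<zeta>))"
          by (rule line_degree_less_mono[OF lh[OF \<zeta> t]])
        then show ?thesis
          by (rule line_degree_less_factor) (use False in \<open>simp add: inner_commute\<close>)
      next
        case perp: True
        have same: "{e \<in> insert x X. \<zeta> \<bullet> v e \<noteq> 0} = {e \<in> X. \<zeta> \<bullet> v e \<noteq> 0}"
          using perp by auto
        show ?thesis
        proof (cases "perp_eps v JJ \<zeta> \<le> perp_eps v ?JD \<zeta>")
          case True
          let ?k = "off_count v X \<zeta> + perp_eps v ?JD \<zeta>"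
          have lh': "line_degree_less (linear_poly (v x) * h) t \<zeta> ?k" if "t \<in> U" for t
            using True same by (intro line_degree_less_mono[OF lh[OF \<zeta> that]]) (simp add: off_count_def)
          have *: "line_degree_less h t \<zeta> ?k" if "t \<in> U" "v x \<bullet> t \<noteq> 0" for t
            using line_degree_less_factor_perp[OF lh'[OF that(1)]] perp that(2) by (simp add: inner_commute)
          show ?thesis
          proof (cases "v x \<bullet> t = 0")
            case True
            have "line_degree_less h (t + s *\<^sub>R u) (\<zeta> + s *\<^sub>R 0) ?k" if "s \<noteq> 0" for s
              using *[of "t + s *\<^sub>R u"] that True u t U by (simp add: inner_add_right subspace_add subspace_scale)
            then show ?thesis by (rule line_degree_less_limit)
          qed (use * t in blast)
        next
          case False
          then have eps: "perp_eps v JJ \<zeta> = 1" "perp_eps v ?JD \<zeta> = 0"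
            by (auto simp: perp_eps_def split: if_splits)
          \<comment> \<open>Deletion loses the member \<open>T\<close> of \<open>JJ\<close>, so \<open>x\<close> is
            not in the span of the rest of \<open>T\<close>, and \<open>y\<close> can be chosen orthogonal to the
            rest but not to \<open>x\<close>.\<close>
          define T where "T = {e \<in> insert x X. \<zeta> \<bullet> v e = 0}"
          have "T - {x} \<notin> JJ"
          proof
            assume "T - {x} \<in> JJ"
            then have "\<exists>I\<in>?JD. \<forall>e\<in>I. \<zeta> \<bullet> v e = 0" by (intro bexI[of _ "T - {x}"]) (auto simp: T_def)
            then show False using eps(2) by (simp add: perp_eps_def)
          qed
          obtain I where I: "I \<in> JJ" "\<forall>e\<in>I. \<zeta> \<bullet> v e = 0"
            using eps(1) by (auto simp: perp_eps_def split: if_splits)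
          have "T \<in> JJ"
            by (rule up[OF I(1)]) (use I JJ_sub[OF I(1)] in \<open>auto simp: T_def\<close>)
          then obtain y where y: "y \<in> U" "\<forall>e\<in>T - {x}. y \<bullet> v e = 0" "\<not> (\<forall>e\<in>T. y \<bullet> v e = 0)"
            using closed[of T "T - {x}"] \<open>T - {x} \<notin> JJ\<close> by (auto simp: T_def)
          then have "y \<bullet> v x \<noteq> 0" by blast
          have "line_degree_less h (t + s *\<^sub>R 0) (\<zeta> + s *\<^sub>R y) (off_count v X \<zeta>)" if s: "s \<noteq> 0" for s
          proof (rule line_degree_less_factor)
            let ?\<xi> = "\<zeta> + s *\<^sub>R y"
            show "v x \<bullet> ?\<xi> \<noteq> 0"
              using s perp \<open>y \<bullet> v x \<noteq> 0\<close> by (simp add: inner_add_right inner_commute)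
            have \<xi>: "?\<xi> \<in> U" using \<zeta> y(1) U by (simp add: subspace_add subspace_scale)
            let ?N = "{e \<in> insert x X. ?\<xi> \<bullet> v e \<noteq> 0}" and ?M = "insert x {e \<in> X. \<zeta> \<bullet> v e \<noteq> 0}"
            have sub: "?N \<subseteq> ?M"
            proof
              fix e assume e: "e \<in> ?N"
              show "e \<in> ?M"
              proof (rule ccontr)
                assume "e \<notin> ?M"
                then have "e \<in> T - {x}" using e by (auto simp: T_def)
                then have "y \<bullet> v e = 0" "\<zeta> \<bullet> v e = 0" using y(2) by (auto simp: T_def)
                then have "?\<xi> \<bullet> v e = 0" by (simp add: inner_add_left)
                then show False using e by simp
              qed
            qed
            have fin: "finite ?M" using insert.hyps by simp
            have card_M: "card ?M = Suc (off_count v X \<zeta>)"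
              using insert.hyps by (simp add: off_count_def)
            \<comment> \<open>Either a further element is orthogonal to the perturbed direction, which lowers the
              count, or the orthogonal elements are those of \<open>T - {x}\<close>, which is not in
              \<open>JJ\<close>.\<close>
            have "off_count v (insert x X) ?\<xi> + perp_eps v JJ ?\<xi> \<le> Suc (off_count v X \<zeta>)"
            proof (cases "?N = ?M")
              case True
              have "perp_eps v JJ ?\<xi> = 0"
              proof (rule ccontr)
                assume "perp_eps v JJ ?\<xi> \<noteq> 0"
                then obtain I where I: "I \<in> JJ" "\<forall>e\<in>I. ?\<xi> \<bullet> v e = 0"
                  by (auto simp: perp_eps_def split: if_splits)
                have "I \<subseteq> T - {x}"
                proof
                  fix e assume "e \<in> I"
                  then have "e \<in> insert x X" "e \<notin> ?M" using JJ_sub[OF I(1)] I(2) True by blast+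
                  then show "e \<in> T - {x}" by (auto simp: T_def)
                qed
                then have "T - {x} \<in> JJ" by (rule up[OF I(1)]) (auto simp: T_def)
                then show False using \<open>T - {x} \<notin> JJ\<close> by blast
              qed
              then show ?thesis using card_M True by (simp add: off_count_def)
            next
              case False
              then have "card ?N < card ?M" using sub fin by (intro psubset_card_mono) auto
              moreover have "perp_eps v JJ ?\<xi> \<le> 1" by (simp add: perp_eps_def)
              ultimately show ?thesis using card_M by (simp add: off_count_def)
            qed
            then show "line_degree_less (linear_poly (v x) * h) (t + s *\<^sub>R 0) ?\<xi> (Suc (off_count v X \<zeta>))"
              using lh[OF \<xi> t] by (simp add: line_degree_less_mono)
          qed
          then have "line_degree_less h t \<zeta> (off_count v X \<zeta>)" by (rule line_degree_less_limit)
          then show ?thesis by (rule line_degree_less_mono) simp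
        qed
      qed
    qed
    then obtain g2 where g2: "g2 \<in> P_semi_external v X ?JD" "\<And>t. t \<in> U \<Longrightarrow> value_at t h = value_at t g2" by blast
    have "g1 + linear_poly (v x) * g2 \<in> P_semi_external v (insert x X) JJ"
      using g1_mem linear_poly_mult_P_semi_external[OF insert.hyps(1,2) g2(1)]
      by (rule cpoly.subspace_add[OF subspace_P_semi_external])
    moreover have "value_at t f = value_at t (g1 + linear_poly (v x) * g2)" if "t \<in> U" for t
      using diff[OF that] g2(2)[OF that] by (simp add: value_at_add value_at_diff value_at_mult algebra_simps)
    ultimately show ?thesis by blast
  qed
qed

section \<open>Differential conditions and the decomposition\<close>

lemma subspace_set_sum:
  fixes D :: "'i \<Rightarrow> 'n cpoly set"
  assumes "finite K" "\<And>i. cpoly.subspace (D i)"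
  shows "cpoly.subspace (\<Sum>i\<in>K. D i)"
  unfolding set_sum_alt[OF assms(1)]
proof (rule cpoly.subspaceI)
  show "0 \<in> {\<Sum>i\<in>K. s i | s. \<forall>i\<in>K. s i \<in> D i}"
    using cpoly.subspace_0[OF assms(2)] by (intro CollectI exI[of _ "\<lambda>_. 0"]) simp
next
  fix p q
  assume "p \<in> {\<Sum>i\<in>K. s i | s. \<forall>i\<in>K. s i \<in> D i}" "q \<in> {\<Sum>i\<in>K. s i | s. \<forall>i\<in>K. s i \<in> D i}"
  then obtain s s' where "p = (\<Sum>i\<in>K. s i)" "\<forall>i\<in>K. s i \<in> D i"
    "q = (\<Sum>i\<in>K. s' i)" "\<forall>i\<in>K. s' i \<in> D i" by blast
  then show "p + q \<in> {\<Sum>i\<in>K. s i | s. \<forall>i\<in>K. s i \<in> D i}"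
    by (intro CollectI exI[of _ "\<lambda>i. s i + s' i"])
      (simp add: sum.distrib cpoly.subspace_add[OF assms(2)])
next
  fix c p
  assume "p \<in> {\<Sum>i\<in>K. s i | s. \<forall>i\<in>K. s i \<in> D i}"
  then obtain s where "p = (\<Sum>i\<in>K. s i)" "\<forall>i\<in>K. s i \<in> D i" by blast
  then show "poly_scale c p \<in> {\<Sum>i\<in>K. s i | s. \<forall>i\<in>K. s i \<in> D i}"
    by (intro CollectI exI[of _ "\<lambda>i. poly_scale c (s i)"])
      (simp add: cpoly.scale_sum_right cpoly.subspace_scale[OF assms(2)])
qed

context semi_external_arrangement
begin

text \<open>The polynomials satisfying the differential equations given by the generators of \<open>ideal_eps\<close> lie in
  \<open>P_semi_external\<close>. The deletion-contraction argument is applied to the closure \<open>JJ\<close> of \<open>J\<close> under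
  spans among all, possibly dependent, subsets.\<close>

theorem mem_P_semi_external_if_facet_degrees:
  assumes facet_degrees: "\<And>F t. F \<in> facets v E \<Longrightarrow>
    line_degree_less f t (\<eta> F) (card (outside v E F) + facet_eps v J F)"
  shows "f \<in> P_semi_external v E J"
proof -
  have degrees: "line_degree_less f t \<zeta> (off_count v E \<zeta> + perp_eps v J \<zeta>)" for t \<zeta>
  proof -
    have "(dir_deriv \<zeta> ^^ (off_count v E \<zeta> + perp_eps v J \<zeta>)) f \<in> {0}"
    proof (rule direction_power_mem)
      show "module_hom poly_scale poly_scale (dir_deriv \<zeta>)" for \<zeta> :: "real ^ 'n"
        by (intro module_hom.intro module_hom_axioms.intro cpoly.module_axioms dir_deriv_add dir_deriv_scale)
      show "(dir_deriv (\<eta> F) ^^ (card (outside v E F) + facet_eps v J F)) f \<in> {0}" if "F \<in> facets v E" for F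
        using facet_degrees[OF that] by (simp add: higher_dir_deriv_eq_0_iff)
    qed (simp_all add: dir_deriv_vec_add dir_deriv_vec_scaleR dir_deriv_commute cpoly.subspace_single_0)
    then show ?thesis by (simp add: higher_dir_deriv_eq_0_iff)
  qed
  define JJ where "JJ = {T. T \<subseteq> E \<and> (\<exists>I\<in>J. v ` I \<subseteq> span (v ` T))}"
  have J_sub: "I \<subseteq> E" if "I \<in> J" for I
    using that semi_external by (auto simp: semi_external_def indep_sets_def)
  have "\<exists>g\<in>P_semi_external v E JJ. \<forall>t\<in>UNIV. value_at t f = value_at t g"
  proof (rule mem_P_semi_external_if_line_degree_less[OF finite_E subspace_UNIV])
    show "T \<subseteq> E" if "T \<in> JJ" for T using that by (simp add: JJ_def)
    show "T' \<in> JJ" if T: "T \<in> JJ" "T' \<subseteq> E"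
      "\<And>u. u \<in> UNIV \<Longrightarrow> \<forall>e\<in>T'. u \<bullet> v e = 0 \<Longrightarrow> \<forall>e\<in>T. u \<bullet> v e = 0" for T T'
    proof -
      have "v e \<in> span (v ` T')" if e: "e \<in> T" for e
      proof -
        obtain y z where yz: "y \<in> span (v ` T')" "\<And>w. w \<in> span (v ` T') \<Longrightarrow> orthogonal z w" "v e = y + z"
          using orthogonal_subspace_decomp_exists[of "v ` T'" "v e"] by blast
        have "\<forall>e\<in>T'. z \<bullet> v e = 0"
          using yz(2) by (auto simp: orthogonal_def span_base)
        then have "z \<bullet> v e = 0" using T(3)[of z] e by blast
        moreover have "z \<bullet> y = 0" using yz(1,2) by (simp add: orthogonal_def)
        ultimately have "z = 0" using yz(3) by (simp add: inner_add_right)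
        then show ?thesis using yz by simp
      qed
      then have "span (v ` T) \<subseteq> span (v ` T')" by (intro span_minimal) auto
      moreover obtain I where "I \<in> J" "v ` I \<subseteq> span (v ` T)" using T(1) by (auto simp: JJ_def)
      ultimately have "v ` I \<subseteq> span (v ` T')" by blast
      then show ?thesis using \<open>I \<in> J\<close> T(2) by (auto simp: JJ_def)
    qed
    show "line_degree_less f t \<zeta> (off_count v E \<zeta> + perp_eps v JJ \<zeta>)" for \<zeta> t
    proof (rule line_degree_less_mono[OF degrees])
      have "J \<subseteq> JJ"
      proof
        fix I assume "I \<in> J"
        moreover have "v ` I \<subseteq> span (v ` I)" by (rule span_superset)
        ultimately show "I \<in> JJ" using J_sub by (auto simp: JJ_def)
      qed
      then show "off_count v E \<zeta> + perp_eps v J \<zeta> \<le> off_count v E \<zeta> + perp_eps v JJ \<zeta>"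
        by (auto simp: perp_eps_def)
    qed
  qed
  then obtain g where g: "g \<in> P_semi_external v E JJ" "\<And>t. value_at t f = value_at t g" by blast
  have "f - g = 0" by (rule value_at_eq_0_imp_0) (simp add: value_at_diff g(2))
  moreover have "P_semi_external v E JJ \<subseteq> P_semi_external v E J"
  proof (rule P_semi_external_mono)
    fix Y T assume T: "T \<in> JJ" "Y \<inter> T = {}"
    then obtain I where I: "I \<in> J" "v ` I \<subseteq> span (v ` T)" "T \<subseteq> E" by (auto simp: JJ_def)
    obtain B where B: "B \<subseteq> T" "B \<in> indep_sets v E" "span (v ` B) = span (v ` T)"
      using ex_indep_spanning[OF I(3)] by metis
    then have "B \<in> J" using J_upward[OF I(1) B(2)] I(2) by simp
    then show "\<exists>I'\<in>J. Y \<inter> I' = {}" using T(2) B(1) by blast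
  qed simp
  ultimately show ?thesis using g(1) by auto
qed

text \<open>If \<open>I\<close> lies in \<open>F\<close>, complete it to a basis of \<open>F\<close> first, which belongs to \<open>J\<close>; one more element
  completes it to a basis of the whole space, and \<open>\<epsilon>(F) = 1\<close>. If \<open>I\<close> is not contained in \<open>F\<close>, then
  \<open>I\<close> together with the elements in \<open>F\<close> spans, so elements of \<open>F\<close> complete \<open>I\<close>.\<close>

lemma ex_completion_near_facet:
  assumes I: "I \<in> J" and F: "F \<in> facets v E"
  obtains Z where "Z \<in> completions v E I" "card {e \<in> Z. v e \<notin> F} \<le> facet_eps v J F"
proof -
  have I_indep: "I \<in> indep_sets v E" using I semi_external by (auto simp: semi_external_def)
  then have "I \<subseteq> E" by (simp add: indep_sets_def)
  define G where "G = {e \<in> E. v e \<in> F}"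
  obtain Y where Y: "Y \<subseteq> E" "F = span (v ` Y)" and dim_F: "dim F = CARD('n) - 1"
    using F by (auto simp: facets_def)
  have "Y \<subseteq> G" using Y by (auto simp: G_def span_base)
  have span_G: "span (v ` G) = F"
  proof
    show "span (v ` G) \<subseteq> F" unfolding Y(2) by (rule span_minimal) (auto simp: G_def Y(2))
    show "F \<subseteq> span (v ` G)" unfolding Y(2) using \<open>Y \<subseteq> G\<close> by (intro span_mono) blast
  qed
  show thesis
  proof (cases "v ` I \<subseteq> F")
    case True
    then have "I \<subseteq> G" using \<open>I \<subseteq> E\<close> by (auto simp: G_def)
    then obtain B0 where B0: "I \<subseteq> B0" "B0 \<subseteq> G" "B0 \<in> indep_sets v E" "span (v ` B0) = F"
      using extend_indep_spanning[OF I_indep, of G] span_G by (auto simp: G_def)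
    have "B0 \<subseteq> E" using B0(2) by (auto simp: G_def)
    then obtain B where B: "B0 \<subseteq> B" "B \<subseteq> E" "B \<in> indep_sets v E" "span (v ` B) = UNIV"
      using extend_indep_spanning[OF B0(3) _ order_refl] spanning by metis
    have card_eq: "card B' = dim (span (v ` B'))" if "B' \<in> indep_sets v E" for B'
      using that by (simp add: indep_sets_def dim_eq_card_independent card_image)
    have "card B = CARD('n)" using card_eq[OF B(3)] B(4) by simp
    moreover have "card B0 = CARD('n) - 1" using card_eq[OF B0(3)] B0(4) dim_F by simp
    moreover have "finite B" using B(2) finite_E finite_subset by blast
    ultimately have "card (B - B0) \<le> 1"
      using B(1) by (simp add: card_Diff_subset finite_subset)
    moreover have "card {e \<in> B - I. v e \<notin> F} \<le> card (B - B0)"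
      using B0(2) \<open>finite B\<close> by (intro card_mono) (auto simp: G_def)
    moreover have "facet_eps v J F = 1"
    proof -
      have "B0 \<in> J" using J_upward[OF I B0(3)] B0(4) True by simp
      then show ?thesis using B0(4) by (auto simp: facet_eps_def)
    qed
    moreover have "B - I \<in> completions v E I"
      using B B0(1) by (auto simp: completions_def bases_def Un_absorb1)
    ultimately show thesis using that[of "B - I"] by simp
  next
    case False
    then obtain w where w: "w \<in> v ` I" "w \<notin> F" by blast
    have "dim (insert w F) = CARD('n)"
      using w(2) dim_F Y(2) by (simp add: dim_insert span_span)
    then have "span (insert w F) = UNIV" by (simp flip: dim_eq_full)
    moreover have "insert w F \<subseteq> span (v ` (I \<union> G))"
    proof -
      have "F \<subseteq> span (v ` (I \<union> G))" using span_G by (metis Un_upper2 image_mono span_mono)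
      moreover have "w \<in> span (v ` (I \<union> G))" using w(1) by (auto intro: span_base)
      ultimately show ?thesis by simp
    qed
    ultimately have "span (v ` (I \<union> G)) = UNIV"
      using span_minimal[OF _ subspace_span] by (metis top.extremum_uniqueI)
    moreover have "I \<union> G \<subseteq> E" using \<open>I \<subseteq> E\<close> by (auto simp: G_def)
    ultimately obtain B where B: "I \<subseteq> B" "B \<subseteq> I \<union> G" "B \<in> indep_sets v E" "span (v ` B) = UNIV"
      using extend_indep_spanning[OF I_indep, of "I \<union> G"] by auto
    have "B - I \<in> completions v E I"
      using B \<open>I \<union> G \<subseteq> E\<close> by (auto simp: completions_def bases_def Un_absorb1)
    moreover have "{e \<in> B - I. v e \<notin> F} = {}" using B(2) by (auto simp: G_def)
    then have "card {e \<in> B - I. v e \<notin> F} \<le> facet_eps v J F" by (simp only: card.empty)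
    ultimately show thesis by (rule that)
  qed
qed

text \<open>A member of \<open>P_central\<close> has degree less than the number of elements outside \<open>F\<close> along the normal of
  \<open>F\<close>, and a suitable \<open>Z\<close> adds at most \<open>\<epsilon>(F)\<close> to that number.\<close>

lemma completions_subset_P_semi_external:
  assumes I: "I \<in> J"
  shows "(\<Inter>Z\<in>completions v E I. P_central_union v E Z) \<subseteq> P_semi_external v E J"
proof
  fix f assume f: "f \<in> (\<Inter>Z\<in>completions v E I. P_central_union v E Z)"
  show "f \<in> P_semi_external v E J"
  proof (rule mem_P_semi_external_if_facet_degrees)
    fix F t assume F: "F \<in> facets v E"
    obtain Z where Z: "Z \<in> completions v E I" "card {e \<in> Z. v e \<notin> F} \<le> facet_eps v J F"
      using ex_completion_near_facet[OF I F] by blast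
    have "finite Z" using Z(1) finite_E by (auto simp: completions_def finite_subset)
    have "line_degree_less f t (\<eta> F) (off_count (case_sum v v) (E <+> Z) (\<eta> F))"
    proof (rule line_degree_less_P_central)
      show "f \<in> P_central (case_sum v v) (E <+> Z)"
        using f Z(1) by (auto simp: P_central_union_def)
      show "\<eta> F \<noteq> 0" using normals F by (simp add: facet_normals_def)
    qed (use finite_E \<open>finite Z\<close> in simp)
    moreover have "off_count (case_sum v v) (E <+> Z) (\<eta> F) = off_count v E (\<eta> F) + off_count v Z (\<eta> F)"
    proof -
      have "{e \<in> E <+> Z. \<eta> F \<bullet> case_sum v v e \<noteq> 0} =
          {e \<in> E. \<eta> F \<bullet> v e \<noteq> 0} <+> {e \<in> Z. \<eta> F \<bullet> v e \<noteq> 0}"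
        by auto
      then show ?thesis
        using finite_E \<open>finite Z\<close> by (simp add: off_count_def card_Plus)
    qed
    moreover have "off_count v Z (\<eta> F) = card {e \<in> Z. v e \<notin> F}"
      unfolding off_count_def using facet_eq_hyperplane[OF normals F]
      by (metis (mono_tags, lifting) mem_Collect_eq)
    ultimately show "line_degree_less f t (\<eta> F) (card (outside v E F) + facet_eps v J F)"
      using Z(2) by (simp add: card_outside_eq_off_count[OF F] line_degree_less_mono)
  qed
qed

lemma prod_poly_mem_P_central_union:
  assumes "Y \<subseteq> E" "I \<subseteq> E" "Y \<inter> I = {}" "Z \<in> completions v E I"
  shows "prod_poly v Y \<in> P_central_union v E Z"
  unfolding P_central_union_def P_central_def
proof (intro cpoly.span_base CollectI exI conjI)
  show "prod_poly v Y = prod_poly (case_sum v v) (Inl ` Y)"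
    by (simp add: prod_poly_def prod.reindex)
  show "Inl ` Y \<subseteq> E <+> Z" using assms by auto
  have "v ` (I \<union> Z) \<subseteq> case_sum v v ` ((E <+> Z) - Inl ` Y)"
  proof
    fix w assume "w \<in> v ` (I \<union> Z)"
    then consider e where "e \<in> I" "w = v e" | e where "e \<in> Z" "w = v e" by blast
    then show "w \<in> case_sum v v ` ((E <+> Z) - Inl ` Y)"
    proof cases
      case 1
      then show ?thesis using assms by (intro image_eqI[of _ _ "Inl e"]) auto
    next
      case 2
      then show ?thesis by (intro image_eqI[of _ _ "Inr e"]) auto
    qed
  qed
  moreover have "span (v ` (I \<union> Z)) = UNIV"
    using assms(4) by (simp add: completions_def bases_def)
  ultimately have "span (case_sum v v ` ((E <+> Z) - Inl ` Y)) = UNIV"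
    by (metis span_mono top.extremum_uniqueI)
  then show "dim (case_sum v v ` ((E <+> Z) - Inl ` Y)) = CARD('n)"
    by (simp flip: dim_eq_full)
qed

theorem P_semi_external_eq:
  "P_semi_external v E J = (\<Sum>I\<in>minimal_in J. \<Inter>Z\<in>completions v E I. P_central_union v E Z)"
proof -
  let ?D = "\<lambda>I. \<Inter>Z\<in>completions v E I. P_central_union v E Z"
  have J_sub: "J \<subseteq> Pow E"
    using semi_external by (auto simp: semi_external_def indep_sets_def)
  then have "finite J" using finite_E by (simp add: finite_subset)
  then have fin: "finite (minimal_in J)" by (simp add: minimal_in_def)
  have D: "cpoly.subspace (?D I)" for I
    by (rule cpoly.subspace_Inter) (auto simp: P_central_union_def P_central_def)
  have sum_D: "(\<Sum>I\<in>minimal_in J. ?D I) = {\<Sum>I\<in>minimal_in J. s I | s. \<forall>I\<in>minimal_in J. s I \<in> ?D I}"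
    by (rule set_sum_alt[OF fin])
  show ?thesis
  proof
    have "cpoly.subspace (\<Sum>I\<in>minimal_in J. ?D I)"
      by (rule subspace_set_sum[OF fin D])
    moreover have "{prod_poly v Y | Y. Y \<subseteq> E \<and> (\<exists>I\<in>J. Y \<inter> I = {})} \<subseteq> (\<Sum>I\<in>minimal_in J. ?D I)"
    proof safe
      fix Y I assume Y: "Y \<subseteq> E" "I \<in> J" "Y \<inter> I = {}"
      obtain I0 where I0: "I0 \<in> J" "I0 \<subseteq> I" "\<forall>I'\<in>J. I' \<subseteq> I0 \<longrightarrow> I0 = I'"
        using finite_has_minimal2[OF \<open>finite J\<close> Y(2)] by blast
      then have min: "I0 \<in> minimal_in J" by (auto simp: minimal_in_def)
      have "prod_poly v Y \<in> ?D I0"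
        using prod_poly_mem_P_central_union[of Y I0] Y I0 J_sub by blast
      then have "\<forall>I\<in>minimal_in J. (if I = I0 then prod_poly v Y else 0) \<in> ?D I"
        using cpoly.subspace_0[OF D] by simp
      moreover have "(\<Sum>I\<in>minimal_in J. if I = I0 then prod_poly v Y else 0) = prod_poly v Y"
        using min fin by simp
      ultimately show "prod_poly v Y \<in> (\<Sum>I\<in>minimal_in J. ?D I)"
        unfolding sum_D by (intro CollectI exI[of _ "\<lambda>I. if I = I0 then prod_poly v Y else 0"]) simp
    qed
    ultimately show "P_semi_external v E J \<subseteq> (\<Sum>I\<in>minimal_in J. ?D I)"
      unfolding P_semi_external_def by (intro cpoly.span_minimal)
  next
    show "(\<Sum>I\<in>minimal_in J. ?D I) \<subseteq> P_semi_external v E J"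
      unfolding sum_D
    proof safe
      fix s assume "\<forall>I\<in>minimal_in J. s I \<in> ?D I"
      then have "s I \<in> P_semi_external v E J" if "I \<in> minimal_in J" for I
        using that completions_subset_P_semi_external[of I] by (auto simp: minimal_in_def)
      then show "(\<Sum>I\<in>minimal_in J. s I) \<in> P_semi_external v E J"
        by (rule cpoly.subspace_sum[OF subspace_P_semi_external])
    qed
  qed
qed

end

theorem theorem2p8:
  fixes v :: "'e \<Rightarrow> real ^ 'n"
    and E :: "'e set"
    and J :: "'e set set"
    and \<eta> :: "(real ^ 'n) set \<Rightarrow> real ^ 'n"
  assumes "finite E"
    and "\<forall>e\<in>E. v e \<noteq> 0"
    and "span (v ` E) = UNIV"
    and "facet_normals v E \<eta>"
    and "semi_external v E J"
    and "bases v E \<subseteq> J"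
    and "\<forall>I \<in> indep_sets v E - bases v E. facet_spanning v E I \<subseteq> J \<longrightarrow> I \<in> J"
  shows "ideal_semi_external v E J \<eta> = ideal_eps v E J \<eta> \<and>
    P_semi_external v E J =
      (\<Sum>I\<in>minimal_in J. \<Inter>Z\<in>completions v E I. P_central_union v E Z)"
proof -
  interpret semi_external_arrangement v E J \<eta>
    using assms by unfold_locales auto
  show ?thesis
    using ideal_semi_external_eq P_semi_external_eq by blast
qed

end
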